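(* Let $f:\mathbb{R}^n\to\mathbb{R}$ be a $C^2$ function satisfying the standing assumptions on $f$ (see context) on the compact neighbourhood $\mathcal N$. Let $\Psi:\mathbb{R}^{n_1}\to\mathbb{R}^{n_2}$ be a general $C^2$ mapping, $\Phi(x_1)=(x_1,\Psi(x_1))$, $F=f\circ\Phi$, $\mathcal M_F=\Phi(\mathbb{R}^{n_1})$, $\mathcal M_F^{\mathrm{loc}}=\mathcal M_F\cap\mathcal N$. Let $\sigma_1\ge\dots\ge\sigma_n$ be the singular values of $\nabla^2f(x)$, and suppose that for every $x\in\mathcal M_F^{\mathrm{loc}}$ the largest one, $\sigma_{\max}(\nabla^2 f(x))$, has multiplicity $p\ge1$ with dominant subspace $\Sigma_{\max}(x)$. Suppose there is a uniform $\varepsilon\in(0,1]$ with $\|\mathrm P_{\mathrm T_x\mathcal M_F^{\mathrm{loc}}}v\|\le1-\varepsilon$ for all $x\in\mathcal M_F^{\mathrm{loc}}$ and all unit $v\in\Sigma_{\max}(x)$ ($\mathrm P$ denoting orthogonal projection), and that $\Delta_{\max}:=\inf_{x\in\mathcal M_F^{\mathrm{loc}}}[\sigma_{\max}(\nabla^2 f(x))-\sigma_{p+1}(\nabla^2 f(x))]>0$. Assume moreover: 1. There exist constants $Q,Z>0$ such that, for all $x_1$ with $\Phi(x_1)\in\mathcal M_F^{\mathrm{loc}}$, $\|\mathrm D^2\Psi(x_1)\|\le Q$ and $\|\nabla_{x_2}f(x_1,\Psi(x_1))\|\le Z$. 2. The correction term satisfies $\dfrac{QZ}{m^{(\Phi)}}<\delta$,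 where $m^{(\Phi)}=\lambda_{\min}(\mathrm D\Phi^\top\mathrm D\Phi)$ and $\delta$ is the curvature gap $$\delta:=\sigma_{\max}\big(\nabla^2f(\Phi(x_1))\big)-\sigma_{\max}\Big(\nabla^2f(\Phi(x_1))\big|_{\mathrm T_{\Phi(x_1)}\mathcal M_F^{\mathrm{loc}}}\Big).$$ Then the reduced function $F$ has a Lipschitz continuous Riemannian gradient (with respect to the pullback metric on $\mathbb{R}^{n_1}$ induced by $\Phi$) with constant $\beta_F$ satisfying $$\beta_F\le\beta_f-\Delta_{\max}(2\varepsilon-\varepsilon^2)+\frac{QZ}{m^{(\Phi)}}<\beta_f.$$ In particular, when $\Psi$ is an orthogonal projection, $m^{(\Phi)}=1$.
   Context: Write $n=n_1+n_2$ with $n_1,n_2\ge 1$, and $x=(x_1,x_2)\in\mathbb{R}^{n_1}\times\mathbb{R}^{n_2}$. The set of minimisers is $\mathcal S=\{x\in\mathbb{R}^n: x\text{ is a local minimum of } f,\ f(x)=0\}$. Standing assumptions on $f$: there are constants $L,\beta_f,\mu_f>0$ and a compact neighbourhood $\mathcal N\subset\mathbb{R}^n$ of a minimiser $\bar x$ such that (i) $f$ attains its infimum, which equals $0$, and $\mathcal S\neq\emptyset$; (ii) on $\mathcal N$, $f$ is $L$-Lipschitz and $\beta_f$-smooth (its gradient is $\beta_f$-Lipschitz); (iii) $f(x)\le\frac{1}{2\mu_f}\|\nabla f(x)\|^2$ for every $x\in\mathcal N$. Standing assumptions on $F$: $F$ is $\beta_F$-smooth in the neighbourhood, and $\mathcal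 S_F:=\mathcal M_F\cap\mathcal S$ is non-empty and forms the set of minimisers of $F$. Dominant subspace: $\Sigma_{\max}(x)=\mathrm{span}\{v:\nabla^2 f(x)v=\lambda v,\ |\lambda|=\sigma_{\max}(\nabla^2f(x))\}$. For symmetric $A$ and a subspace $\mathcal V$, $\sigma_{\max}(A|_{\mathcal V})=\max_{w\in\mathcal V,\|w\|=1}|w^\top Aw|$. The norm $\|\mathrm D^2\Psi(x_1)\|$ is the operator (injective) norm of the third-order tensor, i.e. the supremum of its contraction against three unit vectors. The quantities $m^{(\Phi)}$ and $\delta$ are uniform over $x_1$ with $\Phi(x_1)\in\mathcal N$: $m^{(\Phi)}$ is the infimum of the pointwise minimal eigenvalues, and the inequality $QZ/m^{(\Phi)}<\delta$ is required with $\delta$ the infimum of the pointwise gaps. Pullback metric: $\langle u,v\rangle_R=u^\top Rv$ with $R=\mathrm D\Phi(x_1)^\top\mathrm D\Phi(x_1)$. Smoothness constants: $\beta_f=\sup_{x\in\mathcal N}\|\nabla^2 f(x)\|$ (operator norm) and $\beta_F=\sup_{x_1:\Phi(x_1)\in\mathcal N}\|\nabla^2F(x_1)\|_R$, where $\nabla^2F$ is the Hessian in the coordinates $x_1$ and $\|H\|_R=\max_{y\neq0}|y^\top Hy|/(y^\top Ry)$ for symmetric $H$.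
   Formalization: The chain's last inequality can fail; proved instead: β_F ≤ the middle bound, and β_F < β_f. Gradients are compared via fixed coordinate vectors (coordinate Hessian), as the constant fails for Levi-Civita transport. The projection is onto a proper subspace (m=2 for the identity). *)

theory Defs
  imports "HOL-Analysis.Analysis" "HOL-Library.Multiset"
begin

abbreviation deriv1 :: "('a::euclidean_space \<Rightarrow> 'b::euclidean_space) \<Rightarrow> 'a \<Rightarrow> 'a \<Rightarrow> 'b" where
  "deriv1 g x \<equiv> frechet_derivative g (at x)"

definition deriv2 :: "('a::euclidean_space \<Rightarrow> 'b::euclidean_space) \<Rightarrow> 'a \<Rightarrow> 'a \<Rightarrow> 'a \<Rightarrow> 'b" where
  "deriv2 g x u v = frechet_derivative (\<lambda>y. deriv1 g y v) (at x) u"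

text \<open>In finite dimension it is enough to ask differentiability and continuity for the
  evaluations of the first and second derivatives at fixed vectors.\<close>

definition C2_map :: "('a::euclidean_space \<Rightarrow> 'b::euclidean_space) \<Rightarrow> bool" where
  "C2_map g \<longleftrightarrow>
     (\<forall>x. g differentiable (at x)) \<and>
     (\<forall>v x. (\<lambda>y. deriv1 g y v) differentiable (at x)) \<and>
     (\<forall>u v. continuous_on UNIV (\<lambda>x. deriv2 g x u v))"

definition gradient :: "('a::euclidean_space \<Rightarrow> real) \<Rightarrow> 'a \<Rightarrow> 'a" where
  "gradient f x = (THE d. GDERIV f x :> d)"

definition hessian :: "('a::euclidean_space \<Rightarrow> real) \<Rightarrow> 'a \<Rightarrow> 'a \<Rightarrow> 'a" where
  "hessian f x = deriv1 (gradient f) x"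

definition bilinear_norm :: "('a::euclidean_space \<Rightarrow> 'a \<Rightarrow> 'b::euclidean_space) \<Rightarrow> real" where
  "bilinear_norm B =
     (SUP (u, v, w) \<in> sphere 0 1 \<times> sphere 0 1 \<times> sphere 0 1. w \<bullet> B u v)"

text \<open>The list of singular values in decreasing order, each repeated according to its
  multiplicity \<open>dim (ker (A\<^sup>* A - s\<^sup>2))\<close>.\<close>

definition gram_eigenspace :: "('a::euclidean_space \<Rightarrow> 'b::euclidean_space) \<Rightarrow> real \<Rightarrow> 'a set" where
  "gram_eigenspace A s = {v. adjoint A (A v) = s\<^sup>2 *\<^sub>R v}"

definition singular_values :: "('a::euclidean_space \<Rightarrow> 'b::euclidean_space) \<Rightarrow> real list" where
  "singular_values A =
     rev (sorted_list_of_multiset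
       (\<Sum>s \<in> {s. 0 \<le> s \<and> gram_eigenspace A s \<noteq> {0}}.
          replicate_mset (dim (gram_eigenspace A s)) s))"

text \<open>Indices start at 1, as in \<open>\<sigma>\<^sub>1 \<ge> \<dots> \<ge> \<sigma>\<^sub>n\<close>.\<close>

definition singular_value :: "('a::euclidean_space \<Rightarrow> 'b::euclidean_space) \<Rightarrow> nat \<Rightarrow> real" where
  "singular_value A k = singular_values A ! (k - 1)"

definition sigma_max :: "('a::euclidean_space \<Rightarrow> 'b::euclidean_space) \<Rightarrow> real" where
  "sigma_max A = singular_value A 1"

definition sigma_max_multiplicity :: "('a::euclidean_space \<Rightarrow> 'b::euclidean_space) \<Rightarrow> nat" where
  "sigma_max_multiplicity A = count_list (singular_values A) (sigma_max A)"

definition dominant_subspace :: "('a::euclidean_space \<Rightarrow> 'a) \<Rightarrow> 'a set" where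
  "dominant_subspace A = span {v. \<exists>l. A v = l *\<^sub>R v \<and> \<bar>l\<bar> = sigma_max A}"

definition sigma_max_on :: "('a::euclidean_space \<Rightarrow> 'a) \<Rightarrow> 'a set \<Rightarrow> real" where
  "sigma_max_on A V = (SUP w \<in> {w \<in> V. norm w = 1}. \<bar>w \<bullet> A w\<bar>)"

definition lambda_min :: "('a::euclidean_space \<Rightarrow> 'a) \<Rightarrow> real" where
  "lambda_min A = Min {l. \<exists>v. v \<noteq> 0 \<and> A v = l *\<^sub>R v}"

definition orth_proj :: "'a::euclidean_space set \<Rightarrow> 'a \<Rightarrow> 'a" where
  "orth_proj V x = (THE w. w \<in> V \<and> (\<forall>u\<in>V. (x - w) \<bullet> u = 0))"

text \<open>An orthogonal projection between two different spaces: the orthogonal projection onto a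
  proper subspace \<open>V\<close> of the source, with \<open>V\<close> identified isometrically with a subspace of the
  target by \<open>J\<close>.  (For \<open>V = UNIV\<close> nothing is projected, \<open>\<Psi>\<close> is an isometric embedding and
  \<open>D\<Phi>\<^sup>T D\<Phi>\<close> is twice the identity.)\<close>

definition is_orth_projection :: "('a::euclidean_space \<Rightarrow> 'b::euclidean_space) \<Rightarrow> bool" where
  "is_orth_projection \<Psi> \<longleftrightarrow>
     (\<exists>V J. subspace V \<and> V \<noteq> UNIV \<and> linear J \<and> (\<forall>v\<in>V. norm (J v) = norm v) \<and>
        \<Psi> = (\<lambda>x. J (orth_proj V x)))"

definition zero_minimisers :: "('a::euclidean_space \<Rightarrow> real) \<Rightarrow> 'a set" where
  "zero_minimisers f = {x. (\<forall>\<^sub>F y in nhds x. f x \<le> f y) \<and> f x = 0}"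

definition pullback_metric ::
    "('a::euclidean_space \<Rightarrow> 'b::euclidean_space) \<Rightarrow> 'a \<Rightarrow> 'a \<Rightarrow> 'a" where
  "pullback_metric \<Phi> x = adjoint (deriv1 \<Phi> x) \<circ> deriv1 \<Phi> x"

definition metric_inner :: "('a::euclidean_space \<Rightarrow> 'a) \<Rightarrow> 'a \<Rightarrow> 'a \<Rightarrow> real" where
  "metric_inner R u v = u \<bullet> R v"

definition metric_norm :: "('a::euclidean_space \<Rightarrow> 'a) \<Rightarrow> 'a \<Rightarrow> real" where
  "metric_norm R u = sqrt (metric_inner R u u)"

definition metric_form_norm :: "('a::euclidean_space \<Rightarrow> 'a) \<Rightarrow> ('a \<Rightarrow> 'a) \<Rightarrow> real" where
  "metric_form_norm R H = (SUP y \<in> {y. y \<noteq> 0}. \<bar>y \<bullet> H y\<bar> / metric_inner R y y)"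

definition riemannian_gradient ::
    "('a::euclidean_space \<Rightarrow> 'a \<Rightarrow> 'a) \<Rightarrow> ('a \<Rightarrow> real) \<Rightarrow> 'a \<Rightarrow> 'a" where
  "riemannian_gradient R F x = (THE g. \<forall>v. metric_inner (R x) g v = deriv1 F x v)"

text \<open>Lipschitz continuity of the Riemannian gradient on \<open>U\<close>.  The gradients at the two ends of
  a curve live in different tangent spaces; they are compared by pairing them with the same
  coordinate vector \<open>w\<close>.  This is the comparison belonging to the Hessian in coordinates (for the
  Levi-Civita transport it would be the covariant Hessian).  For a constant metric the supremum
  over \<open>w\<close> with \<open>\<parallel>w\<parallel>\<^sub>R = 1\<close> gives the usual
  \<open>\<parallel>grad F (\<gamma> 1) - grad F (\<gamma> 0)\<parallel>\<^sub>R \<le> \<beta> * length\<^sub>R \<gamma>\<close>.\<close>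

definition riemannian_gradient_lipschitz_on ::
    "real \<Rightarrow> 'a set \<Rightarrow> ('a::euclidean_space \<Rightarrow> 'a \<Rightarrow> 'a) \<Rightarrow> ('a \<Rightarrow> real) \<Rightarrow> bool" where
  "riemannian_gradient_lipschitz_on \<beta> U R F \<longleftrightarrow>
     0 \<le> \<beta> \<and>
     (\<forall>\<gamma> w. \<gamma> C1_differentiable_on {0..1} \<and> \<gamma> ` {0..1} \<subseteq> U \<longrightarrow>
        \<bar>metric_inner (R (\<gamma> 1)) (riemannian_gradient R F (\<gamma> 1)) w
          - metric_inner (R (\<gamma> 0)) (riemannian_gradient R F (\<gamma> 0)) w\<bar>
        \<le> \<beta> * integral {0..1} (\<lambda>t.
              metric_norm (R (\<gamma> t)) (vector_derivative \<gamma> (at t)) * metric_norm (R (\<gamma> t)) w))"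

end

theory Submission
  imports Defs
begin

text \<open>
  Differentiating \<open>F = f \<circ> \<Phi>\<close> twice, with \<open>\<Phi>(x) = (x, \<Psi>(x))\<close>, gives
  \<open>D\<^sup>2F(x)(u, v) = D\<Phi> u \<bullet> \<nabla>\<^sup>2f(\<Phi>(x)) D\<Phi> v + \<nabla>\<^sub>2f(\<Phi>(x)) \<bullet> D\<^sup>2\<Psi>(x)(u, v)\<close>, where \<open>\<nabla>\<^sub>2f\<close> is the
  partial gradient in the second variable (\<open>deriv2_compose_graph\<close>).  In the pullback metric the
  squared length of \<open>u\<close> is \<open>|D\<Phi> u|\<^sup>2\<close>, so the first term contributes the curvature of \<open>f\<close> along the
  tangent space of the graph.  The second is at most \<open>Q Z |u|\<^sup>2\<close> on the diagonal, hence at most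
  \<open>Q Z / m\<close> times the squared metric length (\<open>abs_hessian_compose_graph_le\<close>).

  The tangential curvature is estimated by splitting a unit tangent vector \<open>w = v + z\<close> along the
  dominant subspace of the Hessian \<open>A\<close> of \<open>f\<close> and its orthogonal complement.  Both are invariant
  under \<open>A\<close>, so there are no cross terms and
  \<open>|w \<bullet> A w| \<le> \<sigma>\<^sub>1 |v|\<^sup>2 + s |z|\<^sup>2\<close>, with \<open>\<sigma>\<^sub>1\<close> the largest singular value and \<open>s\<close> the one of index
  \<open>p + 1\<close>.  The angle condition forces \<open>|v| \<le> 1 - \<epsilon>\<close>, which yields
  \<open>\<sigma>\<^sub>1 - (\<sigma>\<^sub>1 - s)(2 \<epsilon> - \<epsilon>\<^sup>2)\<close> (\<open>quadratic_form_on_misaligned_subspace\<close>).  Instead of a spectral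
  decomposition it suffices that a symmetric operator has, on each nonzero invariant subspace, an
  eigenvector at which the modulus of its quadratic form is maximal (\<open>abs_max_eigenvector\<close>).  The
  Hessian is symmetric by the theorem of Schwarz (\<open>deriv2_commute\<close>).

  Since \<open>\<sigma>\<^sub>1\<close> is at most the operator norm of \<open>A\<close>, hence at most \<open>\<beta>\<^sub>f\<close>, this gives the quantitative
  bound on \<open>\<beta>\<^sub>F\<close>; the definition of \<open>\<delta>\<close> in place of the angle condition gives \<open>\<beta>\<^sub>F < \<beta>\<^sub>f\<close>.  By
  polarisation the bound \<open>\<beta>\<^sub>F\<close> on the diagonal of \<open>D\<^sup>2F\<close> is a bound on the bilinear form
  (\<open>symmetric_form_polarization\<close>), and integrating \<open>D\<^sup>2F\<close> along a curve gives the Lipschitz property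
  of the Riemannian gradient (\<open>riemannian_gradient_lipschitz_on_pullback\<close>).  Finally
  \<open>D\<Phi>\<^sup>T D\<Phi> \<ge> 1\<close> always, and when \<open>\<Psi>\<close> is an orthogonal projection the
  value 1 is attained on its kernel.
\<close>

section \<open>Twice continuously differentiable maps\<close>

lemma C2_map_has_derivative:
  "C2_map g \<Longrightarrow> (g has_derivative deriv1 g x) (at x)"
  unfolding C2_map_def by (simp add: frechet_derivative_works)

lemma C2_map_has_derivative_deriv1:
  "C2_map g \<Longrightarrow> ((\<lambda>y. deriv1 g y v) has_derivative (\<lambda>u. deriv2 g x u v)) (at x)"
  unfolding C2_map_def deriv2_def by (simp add: frechet_derivative_works)

lemma deriv1_eqI: "(g has_derivative g') (at x) \<Longrightarrow> deriv1 g x = g'"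
  by (metis frechet_derivative_at)

lemma linear_deriv1: "C2_map g \<Longrightarrow> linear (deriv1 g x)"
  using C2_map_has_derivative has_derivative_linear by blast

lemma deriv2_eqI:
  "((\<lambda>y. deriv1 g y v) has_derivative h) (at x) \<Longrightarrow> deriv2 g x u v = h u"
  unfolding deriv2_def by (simp add: deriv1_eqI)

lemma bilinear_deriv2:
  assumes "C2_map g"
  shows "bilinear (deriv2 g x)"
  unfolding bilinear_def
proof (intro conjI allI)
  show "linear (\<lambda>u. deriv2 g x u v)" for v
    using C2_map_has_derivative_deriv1[OF assms] has_derivative_linear by blast
  show "linear (deriv2 g x u)" for u
  proof (rule linearI)
    fix v w
    have "((\<lambda>y. deriv1 g y v + deriv1 g y w) has_derivative
             (\<lambda>u. deriv2 g x u v + deriv2 g x u w)) (at x)"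
      by (intro has_derivative_add C2_map_has_derivative_deriv1 assms)
    then show "deriv2 g x u (v + w) = deriv2 g x u v + deriv2 g x u w"
      by (intro deriv2_eqI) (simp add: linear_add[OF linear_deriv1[OF assms]])
  next
    fix c v
    have "((\<lambda>y. c *\<^sub>R deriv1 g y v) has_derivative (\<lambda>u. c *\<^sub>R deriv2 g x u v)) (at x)"
      by (intro has_derivative_scaleR_right C2_map_has_derivative_deriv1 assms)
    then show "deriv2 g x u (c *\<^sub>R v) = c *\<^sub>R deriv2 g x u v"
      by (intro deriv2_eqI[where h = "\<lambda>u. c *\<^sub>R deriv2 g x u v"])
         (simp add: linear_scale[OF linear_deriv1[OF assms]])
  qed
qed

text \<open>Expansion in a basis reduces joint statements about \<open>Dg(x) v\<close> and \<open>D\<^sup>2g(x)(u, v)\<close> to the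
  evaluations at fixed vectors, whose regularity is what the definition of a \<open>C\<^sup>2\<close> map provides.\<close>

lemma linear_eq_sum_Basis:
  fixes l :: "'a::euclidean_space \<Rightarrow> 'b::real_vector"
  assumes "linear l"
  shows "l w = (\<Sum>b\<in>Basis. (w \<bullet> b) *\<^sub>R l b)"
proof -
  have "l w = l (\<Sum>b\<in>Basis. (w \<bullet> b) *\<^sub>R b)" by (simp add: euclidean_representation)
  then show ?thesis using assms by (simp add: linear_sum linear_scale)
qed

lemma continuous_on_deriv1:
  assumes g: "C2_map g" and h: "continuous_on S h" and w: "continuous_on S w"
  shows "continuous_on S (\<lambda>x. deriv1 g (h x) (w x))"
proof -
  have 1: "continuous_on UNIV (\<lambda>y. deriv1 g y b)" for b
    by (intro continuous_at_imp_continuous_on ballI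
        has_derivative_continuous[OF C2_map_has_derivative_deriv1[OF g]])
  have "continuous_on S (\<lambda>x. deriv1 g (h x) b)" for b
    using continuous_on_compose2[OF 1 h] by simp
  then have "continuous_on S (\<lambda>x. \<Sum>b\<in>Basis. (w x \<bullet> b) *\<^sub>R deriv1 g (h x) b)"
    by (intro continuous_intros w)
  then show ?thesis
    by (simp add: linear_eq_sum_Basis[OF linear_deriv1[OF g], symmetric])
qed

lemma continuous_on_deriv2:
  assumes g: "C2_map g" and h: "continuous_on S h"
    and u: "continuous_on S u" and w: "continuous_on S w"
  shows "continuous_on S (\<lambda>x. deriv2 g (h x) (u x) (w x))"
proof -
  have 1: "continuous_on UNIV (\<lambda>y. deriv2 g y a b)" for a b
    using g unfolding C2_map_def by blast
  have "continuous_on S (\<lambda>x. deriv2 g (h x) a b)" for a b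
    using continuous_on_compose2[OF 1 h] by simp
  then have 2: "continuous_on S
      (\<lambda>x. \<Sum>a\<in>Basis. (u x \<bullet> a) *\<^sub>R (\<Sum>b\<in>Basis. (w x \<bullet> b) *\<^sub>R deriv2 g (h x) a b))"
    by (intro continuous_intros u w)
  have l: "linear (\<lambda>a. deriv2 g y a c)" "linear (deriv2 g y a)" for y a c
    using bilinear_deriv2[OF g, of y] unfolding bilinear_def by auto
  have "(\<Sum>a\<in>Basis. (u x \<bullet> a) *\<^sub>R (\<Sum>b\<in>Basis. (w x \<bullet> b) *\<^sub>R deriv2 g (h x) a b))
        = deriv2 g (h x) (u x) (w x)" for x
    unfolding linear_eq_sum_Basis[OF l(2), symmetric]
    by (rule linear_eq_sum_Basis[OF l(1), symmetric])
  then have "(\<lambda>x. \<Sum>a\<in>Basis. (u x \<bullet> a) *\<^sub>R (\<Sum>b\<in>Basis. (w x \<bullet> b) *\<^sub>R deriv2 g (h x) a b))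
        = (\<lambda>x. deriv2 g (h x) (u x) (w x))" by (rule ext)
  from subst[of _ _ "continuous_on S", OF this 2] show ?thesis .
qed

text \<open>Differentiating \<open>Dg(h(x)) w(x)\<close> when both the base point and the direction move.\<close>

lemma has_derivative_deriv1_compose:
  assumes g: "C2_map g"
    and h: "(h has_derivative h') (at x within S)"
    and w: "(w has_derivative w') (at x within S)"
  shows "((\<lambda>y. deriv1 g (h y) (w y)) has_derivative
           (\<lambda>u. deriv2 g (h x) (h' u) (w x) + deriv1 g (h x) (w' u))) (at x within S)"
proof -
  have 1: "((\<lambda>y. deriv1 g (h y) b) has_derivative (\<lambda>u. deriv2 g (h x) (h' u) b)) (at x within S)" for b
    by (rule has_derivative_compose[OF h C2_map_has_derivative_deriv1[OF g]])
  have "((\<lambda>y. \<Sum>b\<in>Basis. (w y \<bullet> b) *\<^sub>R deriv1 g (h y) b) has_derivative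
          (\<lambda>u. \<Sum>b\<in>Basis. (w x \<bullet> b) *\<^sub>R deriv2 g (h x) (h' u) b
                           + (w' u \<bullet> b) *\<^sub>R deriv1 g (h x) b)) (at x within S)"
    by (intro has_derivative_sum has_derivative_scaleR has_derivative_inner_left 1 w)
  moreover have "linear (deriv2 g (h x) (h' u))" for u
    using bilinear_deriv2[OF g, of "h x"] unfolding bilinear_def by auto
  ultimately show ?thesis
    by (simp add: sum.distrib linear_eq_sum_Basis[OF linear_deriv1[OF g], symmetric]
        linear_eq_sum_Basis[symmetric])
qed

lemma deriv1_compose:
  assumes "C2_map g" "C2_map h"
  shows "deriv1 (g \<circ> h) x v = deriv1 g (h x) (deriv1 h x v)"
  using deriv1_eqI[OF diff_chain_at[OF C2_map_has_derivative[OF assms(2)]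
        C2_map_has_derivative[OF assms(1)]]] by simp

lemma has_derivative_deriv1_comp:
  assumes g: "C2_map g" and h: "C2_map h"
  shows "((\<lambda>y. deriv1 (g \<circ> h) y v) has_derivative
     (\<lambda>u. deriv2 g (h x) (deriv1 h x u) (deriv1 h x v) + deriv1 g (h x) (deriv2 h x u v))) (at x)"
  unfolding deriv1_compose[OF assms]
  by (intro has_derivative_deriv1_compose g C2_map_has_derivative h C2_map_has_derivative_deriv1)

lemma deriv2_compose:
  assumes "C2_map g" "C2_map h"
  shows "deriv2 (g \<circ> h) x u v =
     deriv2 g (h x) (deriv1 h x u) (deriv1 h x v) + deriv1 g (h x) (deriv2 h x u v)"
  by (rule deriv2_eqI[OF has_derivative_deriv1_comp[OF assms]])

lemma C2_map_continuous_on: "C2_map g \<Longrightarrow> continuous_on S g"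
  by (intro continuous_at_imp_continuous_on ballI has_derivative_continuous[OF C2_map_has_derivative])

lemma C2_map_compose:
  assumes g: "C2_map g" and h: "C2_map h"
  shows "C2_map (g \<circ> h)"
proof -
  have "(g \<circ> h) differentiable (at x)" for x
    using diff_chain_at[OF C2_map_has_derivative[OF h] C2_map_has_derivative[OF g]]
    unfolding differentiable_def by blast
  moreover have "(\<lambda>y. deriv1 (g \<circ> h) y v) differentiable (at x)" for v x
    using has_derivative_deriv1_comp[OF assms] unfolding differentiable_def by blast
  moreover have "continuous_on UNIV (\<lambda>x. deriv2 (g \<circ> h) x u v)" for u v
    unfolding deriv2_compose[OF assms]
    by (intro continuous_on_add continuous_on_deriv2 continuous_on_deriv1 g h
        C2_map_continuous_on[OF h] continuous_on_id continuous_on_const)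
  ultimately show ?thesis unfolding C2_map_def by blast
qed

lemma has_derivative_graph:
  assumes "C2_map \<Psi>"
  shows "((\<lambda>x. (x, \<Psi> x)) has_derivative (\<lambda>v. (v, deriv1 \<Psi> x v))) (at x)"
  by (intro has_derivative_Pair has_derivative_ident C2_map_has_derivative assms)

lemma deriv1_graph:
  assumes "C2_map \<Psi>"
  shows "deriv1 (\<lambda>x. (x, \<Psi> x)) x v = (v, deriv1 \<Psi> x v)"
  by (simp add: deriv1_eqI[OF has_derivative_graph[OF assms]])

lemma has_derivative_deriv1_graph:
  assumes "C2_map \<Psi>"
  shows "((\<lambda>y. deriv1 (\<lambda>x. (x, \<Psi> x)) y v) has_derivative (\<lambda>u. (0, deriv2 \<Psi> x u v))) (at x)"
  unfolding deriv1_graph[OF assms]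
  by (intro has_derivative_Pair has_derivative_const C2_map_has_derivative_deriv1 assms)

lemma deriv2_graph:
  assumes "C2_map \<Psi>"
  shows "deriv2 (\<lambda>x. (x, \<Psi> x)) x u v = (0, deriv2 \<Psi> x u v)"
  by (rule deriv2_eqI[OF has_derivative_deriv1_graph[OF assms]])

lemma C2_map_graph:
  assumes "C2_map \<Psi>"
  shows "C2_map (\<lambda>x. (x, \<Psi> x))"
  unfolding C2_map_def
proof (intro conjI allI)
  show "(\<lambda>x. (x, \<Psi> x)) differentiable (at x)" for x
    using has_derivative_graph[OF assms] unfolding differentiable_def by blast
  show "(\<lambda>y. deriv1 (\<lambda>x. (x, \<Psi> x)) y v) differentiable (at x)" for v x
    using has_derivative_deriv1_graph[OF assms] unfolding differentiable_def by blast
  show "continuous_on UNIV (\<lambda>x. deriv2 (\<lambda>x. (x, \<Psi> x)) x u v)" for u v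
    unfolding deriv2_graph[OF assms]
    using assms unfolding C2_map_def by (intro continuous_on_Pair continuous_on_const) blast
qed

subsection \<open>Symmetry of the second derivative\<close>

text \<open>The mean value theorem, applied once in each direction, to the second difference.\<close>

lemma second_difference:
  fixes g :: "'a::euclidean_space \<Rightarrow> real"
  assumes g: "C2_map g" and t: "0 < t"
  shows "\<exists>\<xi> \<eta>. 0 < \<xi> \<and> \<xi> < t \<and> 0 < \<eta> \<and> \<eta> < t \<and>
     g (x + t *\<^sub>R u + t *\<^sub>R v) - g (x + t *\<^sub>R u) - g (x + t *\<^sub>R v) + g x
       = t\<^sup>2 * deriv2 g (x + \<xi> *\<^sub>R u + \<eta> *\<^sub>R v) v u"
proof -
  have d1: "((\<lambda>s. g (a + s *\<^sub>R w)) has_field_derivative deriv1 g (a + s *\<^sub>R w) w) (at s)" for a w s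
  proof -
    have "((\<lambda>s. a + s *\<^sub>R w) has_derivative (\<lambda>h. h *\<^sub>R w)) (at s)"
      by (auto intro!: derivative_eq_intros)
    from has_derivative_compose[OF this C2_map_has_derivative[OF g]]
    show ?thesis
      by (simp add: has_field_derivative_def linear_scale[OF linear_deriv1[OF g]] mult_commute_abs)
  qed
  have d2: "((\<lambda>s. deriv1 g (a + s *\<^sub>R w) z) has_field_derivative deriv2 g (a + s *\<^sub>R w) w z) (at s)"
    for a w s z
  proof -
    have "((\<lambda>s. a + s *\<^sub>R w) has_derivative (\<lambda>h. h *\<^sub>R w)) (at s)"
      by (auto intro!: derivative_eq_intros)
    from has_derivative_compose[OF this C2_map_has_derivative_deriv1[OF g]]
    show ?thesis
      by (simp add: has_field_derivative_def bilinear_lmul[OF bilinear_deriv2[OF g]] mult_commute_abs)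
  qed
  define \<phi> where "\<phi> = (\<lambda>s. g ((x + t *\<^sub>R v) + s *\<^sub>R u) - g (x + s *\<^sub>R u))"
  have "\<exists>\<xi>>0. \<xi> < t \<and> \<phi> t - \<phi> 0 =
      (t - 0) * (deriv1 g ((x + t *\<^sub>R v) + \<xi> *\<^sub>R u) u - deriv1 g (x + \<xi> *\<^sub>R u) u)"
    unfolding \<phi>_def by (rule MVT2[OF t]) (intro DERIV_diff d1)
  then obtain \<xi> where \<xi>: "0 < \<xi>" "\<xi> < t"
    and e1: "\<phi> t - \<phi> 0 = t * (deriv1 g ((x + t *\<^sub>R v) + \<xi> *\<^sub>R u) u - deriv1 g (x + \<xi> *\<^sub>R u) u)"
    by auto
  have "\<exists>\<eta>>0. \<eta> < t \<and>
      deriv1 g ((x + \<xi> *\<^sub>R u) + t *\<^sub>R v) u - deriv1 g ((x + \<xi> *\<^sub>R u) + 0 *\<^sub>R v) u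
      = (t - 0) * deriv2 g ((x + \<xi> *\<^sub>R u) + \<eta> *\<^sub>R v) v u"
    by (rule MVT2[OF t]) (rule d2)
  then obtain \<eta> where \<eta>: "0 < \<eta>" "\<eta> < t"
    and e2: "deriv1 g ((x + \<xi> *\<^sub>R u) + t *\<^sub>R v) u - deriv1 g (x + \<xi> *\<^sub>R u) u
      = t * deriv2 g ((x + \<xi> *\<^sub>R u) + \<eta> *\<^sub>R v) v u"
    by auto
  have "g (x + t *\<^sub>R u + t *\<^sub>R v) - g (x + t *\<^sub>R u) - g (x + t *\<^sub>R v) + g x = \<phi> t - \<phi> 0"
    by (simp add: \<phi>_def algebra_simps)
  also have "\<dots> = t * (t * deriv2 g ((x + \<xi> *\<^sub>R u) + \<eta> *\<^sub>R v) v u)"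
    using e1 e2 by (simp add: algebra_simps)
  finally show ?thesis using \<xi> \<eta> by (auto simp: power2_eq_square mult.assoc)
qed

text \<open>Schwarz: both orders of differentiation arise as limits of the same second difference,
  divided by \<open>t\<^sup>2\<close>.\<close>

lemma deriv2_commute:
  fixes g :: "'a::euclidean_space \<Rightarrow> real"
  assumes g: "C2_map g"
  shows "deriv2 g x u v = deriv2 g x v u"
proof -
  define K where "K = norm u + norm v"
  have lim: "(\<lambda>n. deriv2 g (y n) a b) \<longlonglongrightarrow> deriv2 g x a b"
    if "\<And>n. norm (y n - x) \<le> inverse (real (Suc n)) * K" for y a b
  proof -
    have 0: "(\<lambda>n. inverse (real (Suc n)) * K) \<longlonglongrightarrow> 0"
      by (rule tendsto_mult_left_zero[OF LIMSEQ_inverse_real_of_nat])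
    have "\<forall>\<^sub>F n in sequentially. norm (y n - x) \<le> inverse (real (Suc n)) * K"
      using that by (intro always_eventually) blast
    then have "(\<lambda>n. y n - x) \<longlonglongrightarrow> 0"
      using 0 by (rule Lim_null_comparison)
    then have "y \<longlonglongrightarrow> x" by (simp add: LIM_zero_iff)
    moreover have "isCont (\<lambda>y. deriv2 g y a b) x"
      using g unfolding C2_map_def by (simp add: continuous_on_eq_continuous_at)
    ultimately show ?thesis by (rule isCont_tendsto_compose[rotated])
  qed
  have near: "norm ((x + \<xi> *\<^sub>R a + \<eta> *\<^sub>R b) - x) \<le> t * (norm a + norm b)"
    if "0 < \<xi>" "\<xi> < t" "0 < \<eta>" "\<eta> < t" for \<xi> \<eta> t a b
  proof -
    have "norm ((x + \<xi> *\<^sub>R a + \<eta> *\<^sub>R b) - x) = norm (\<xi> *\<^sub>R a + \<eta> *\<^sub>R b)"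
      by (simp add: algebra_simps)
    also have "\<dots> \<le> norm (\<xi> *\<^sub>R a) + norm (\<eta> *\<^sub>R b)" by (rule norm_triangle_ineq)
    also have "\<dots> \<le> t * norm a + t * norm b"
      using that by (intro add_mono) (auto intro!: mult_right_mono)
    finally show ?thesis by (simp add: algebra_simps)
  qed
  \<comment> \<open>The second difference is symmetric in \<open>u\<close> and \<open>v\<close>, so its two evaluations by the mean
    value theorem agree, at points within \<open>t (|u| + |v|)\<close> of \<open>x\<close>.\<close>
  have "\<exists>y z. norm (y - x) \<le> inverse (real (Suc n)) * K \<and> norm (z - x) \<le> inverse (real (Suc n)) * K \<and>
          deriv2 g y u v = deriv2 g z v u" for n
  proof -
    define t where "t = inverse (real (Suc n))"
    have t: "0 < t" by (simp add: t_def)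
    obtain \<xi> \<eta> where 1: "0 < \<xi>" "\<xi> < t" "0 < \<eta>" "\<eta> < t"
      and e1: "g (x + t *\<^sub>R u + t *\<^sub>R v) - g (x + t *\<^sub>R u) - g (x + t *\<^sub>R v) + g x
       = t\<^sup>2 * deriv2 g (x + \<xi> *\<^sub>R u + \<eta> *\<^sub>R v) v u"
      using second_difference[OF g t] by blast
    obtain \<xi>' \<eta>' where 2: "0 < \<xi>'" "\<xi>' < t" "0 < \<eta>'" "\<eta>' < t"
      and e2: "g (x + t *\<^sub>R v + t *\<^sub>R u) - g (x + t *\<^sub>R v) - g (x + t *\<^sub>R u) + g x
       = t\<^sup>2 * deriv2 g (x + \<xi>' *\<^sub>R v + \<eta>' *\<^sub>R u) u v"
      using second_difference[OF g t] by blast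
    have "t\<^sup>2 * deriv2 g (x + \<xi>' *\<^sub>R v + \<eta>' *\<^sub>R u) u v = t\<^sup>2 * deriv2 g (x + \<xi> *\<^sub>R u + \<eta> *\<^sub>R v) v u"
      using e1 e2 by (simp only: add.commute[of "t *\<^sub>R u"] add.assoc)
    then have "deriv2 g (x + \<xi>' *\<^sub>R v + \<eta>' *\<^sub>R u) u v = deriv2 g (x + \<xi> *\<^sub>R u + \<eta> *\<^sub>R v) v u"
      using t by simp
    moreover note near[OF 1, of u v] near[OF 2, of v u]
    moreover have "norm v + norm u = K" by (simp add: K_def)
    ultimately show ?thesis unfolding t_def[symmetric] K_def[symmetric] by (intro exI conjI) auto
  qed
  then obtain y z where y: "\<And>n. norm (y n - x) \<le> inverse (real (Suc n)) * K"
    and z: "\<And>n. norm (z n - x) \<le> inverse (real (Suc n)) * K"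
    and eq: "\<And>n. deriv2 g (y n) u v = deriv2 g (z n) v u"
    by metis
  have "(\<lambda>n. deriv2 g (z n) v u) \<longlonglongrightarrow> deriv2 g x u v"
    using lim[OF y, of u v] eq by simp
  then show ?thesis using lim[OF z, of v u] LIMSEQ_unique by blast
qed

subsection \<open>Gradient and Hessian\<close>

lemma inner_gradient:
  fixes f :: "'a::euclidean_space \<Rightarrow> real"
  assumes "(f has_derivative f') (at x)"
  shows "gradient f x \<bullet> v = f' v"
proof -
  have lin: "linear f'" using assms has_derivative_linear by blast
  have "GDERIV f x :> d \<longleftrightarrow> (\<forall>v. f' v = v \<bullet> d)" for d
  proof
    assume "GDERIV f x :> d"
    then have "f' = (\<lambda>v. v \<bullet> d)"
      unfolding gderiv_def using assms has_derivative_unique by blast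
    then show "\<forall>v. f' v = v \<bullet> d" by simp
  next
    assume "\<forall>v. f' v = v \<bullet> d"
    then have "f' = (\<lambda>v. v \<bullet> d)" by auto
    then show "GDERIV f x :> d"
      unfolding gderiv_def using assms by simp
  qed
  moreover have "\<forall>v. f' v = v \<bullet> adjoint f' 1"
    by (simp add: adjoint_works[OF lin])
  moreover have "(\<forall>v. v \<bullet> adjoint f' 1 = v \<bullet> d) \<longleftrightarrow> adjoint f' 1 = d" for d
    by (rule vector_eq_ldot)
  ultimately have ex: "GDERIV f x :> adjoint f' 1"
    and uni: "\<And>d. GDERIV f x :> d \<Longrightarrow> d = adjoint f' 1"
    by auto
  have "gradient f x = adjoint f' 1"
    unfolding gradient_def using ex uni by (rule the_equality)
  then show ?thesis using \<open>\<forall>v. f' v = v \<bullet> adjoint f' 1\<close> by (simp add: inner_commute)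
qed

lemma has_derivative_gradient:
  fixes f :: "'a::euclidean_space \<Rightarrow> real"
  assumes f: "C2_map f"
  shows "(gradient f has_derivative (\<lambda>u. \<Sum>b\<in>Basis. deriv2 f x u b *\<^sub>R b)) (at x)"
proof -
  have "gradient f = (\<lambda>y. \<Sum>b\<in>Basis. deriv1 f y b *\<^sub>R b)"
    by (rule ext, rule euclidean_eqI)
       (simp add: inner_gradient[OF C2_map_has_derivative[OF f]] inner_sum_left inner_Basis
          if_distrib cong: if_cong)
  moreover have "((\<lambda>y. \<Sum>b\<in>Basis. deriv1 f y b *\<^sub>R b) has_derivative
     (\<lambda>u. \<Sum>b\<in>Basis. deriv2 f x u b *\<^sub>R b)) (at x)"
    by (intro has_derivative_sum has_derivative_scaleR_left C2_map_has_derivative_deriv1 f)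
  ultimately show ?thesis by simp
qed

lemma inner_hessian:
  fixes f :: "'a::euclidean_space \<Rightarrow> real"
  assumes f: "C2_map f"
  shows "hessian f x u \<bullet> v = deriv2 f x u v"
proof -
  have "hessian f x u = (\<Sum>b\<in>Basis. deriv2 f x u b *\<^sub>R b)"
    unfolding hessian_def by (simp add: deriv1_eqI[OF has_derivative_gradient[OF f]])
  moreover have "linear (deriv2 f x u)"
    using bilinear_deriv2[OF f, of x] unfolding bilinear_def by auto
  ultimately show ?thesis
    by (simp add: inner_sum_left linear_eq_sum_Basis[of "deriv2 f x u" v] inner_commute[of v] mult.commute)
qed

lemma linear_hessian:
  fixes f :: "'a::euclidean_space \<Rightarrow> real"
  assumes f: "C2_map f"
  shows "linear (hessian f x)"
  unfolding hessian_def
  by (simp add: deriv1_eqI[OF has_derivative_gradient[OF f]]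
      has_derivative_linear[OF has_derivative_gradient[OF f]])

lemma hessian_symmetric:
  fixes f :: "'a::euclidean_space \<Rightarrow> real"
  assumes f: "C2_map f"
  shows "u \<bullet> hessian f x v = hessian f x u \<bullet> v"
  by (simp add: inner_commute[of u] inner_hessian[OF f] deriv2_commute[OF f, of x u])

lemma bdd_above_onorm_hessian:
  fixes f :: "'a::euclidean_space \<Rightarrow> real"
  assumes f: "C2_map f" and N: "compact N"
  shows "bdd_above ((\<lambda>x. onorm (hessian f x)) ` N)"
proof -
  have "continuous_on N (\<lambda>x. \<Sum>a\<in>Basis. \<Sum>b\<in>Basis. \<bar>deriv2 f x a b\<bar>)"
    by (intro continuous_intros continuous_on_deriv2 f)
  then have "compact ((\<lambda>x. \<Sum>a\<in>Basis. \<Sum>b\<in>Basis. \<bar>deriv2 f x a b\<bar>) ` N)"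
    using N compact_continuous_image by blast
  then have "bdd_above ((\<lambda>x. \<Sum>a\<in>Basis. \<Sum>b\<in>Basis. \<bar>deriv2 f x a b\<bar>) ` N)"
    by (intro bounded_imp_bdd_above compact_imp_bounded)
  then obtain K where K: "(\<Sum>a\<in>Basis. \<Sum>b\<in>Basis. \<bar>deriv2 f x a b\<bar>) \<le> K" if "x \<in> N" for x
    by (auto simp: bdd_above_def)
  have "onorm (hessian f x) \<le> (\<Sum>a\<in>Basis. \<Sum>b\<in>Basis. \<bar>deriv2 f x a b\<bar>)" for x
  proof (rule onorm_bound)
    show "0 \<le> (\<Sum>a\<in>Basis. \<Sum>b\<in>Basis. \<bar>deriv2 f x a b\<bar>)" by (intro sum_nonneg) simp
    fix w
    have "norm (hessian f x w) = norm (\<Sum>a\<in>Basis. (w \<bullet> a) *\<^sub>R hessian f x a)"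
      by (simp add: linear_eq_sum_Basis[OF linear_hessian[OF f], symmetric])
    also have "\<dots> \<le> (\<Sum>a\<in>Basis. norm w * (\<Sum>b\<in>Basis. \<bar>deriv2 f x a b\<bar>))"
    proof (rule sum_norm_le)
      fix a :: 'a assume a: "a \<in> Basis"
      have "norm (hessian f x a) \<le> (\<Sum>b\<in>Basis. \<bar>deriv2 f x a b\<bar>)"
        using norm_le_l1[of "hessian f x a"] by (simp add: inner_hessian[OF f])
      then show "norm ((w \<bullet> a) *\<^sub>R hessian f x a) \<le> norm w * (\<Sum>b\<in>Basis. \<bar>deriv2 f x a b\<bar>)"
        using Basis_le_norm[OF a, of w] by (simp add: mult_mono)
    qed
    finally show "norm (hessian f x w) \<le> (\<Sum>a\<in>Basis. \<Sum>b\<in>Basis. \<bar>deriv2 f x a b\<bar>) * norm w"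
      by (simp add: sum_distrib_left mult.commute)
  qed
  then have "onorm (hessian f x) \<le> K" if "x \<in> N" for x
    using K[OF that] order_trans by blast
  then show ?thesis by (intro bdd_aboveI2)
qed

section \<open>Orthogonal projections and symmetric operators\<close>

lemma orth_proj_unique:
  assumes "subspace V" "w \<in> V" "\<And>u. u \<in> V \<Longrightarrow> (x - w) \<bullet> u = 0"
  shows "orth_proj V x = w"
  unfolding orth_proj_def
proof (rule the_equality)
  show "w \<in> V \<and> (\<forall>u\<in>V. (x - w) \<bullet> u = 0)" using assms by blast
  fix w' assume w': "w' \<in> V \<and> (\<forall>u\<in>V. (x - w') \<bullet> u = 0)"
  have "w' - w \<in> V" using assms w' by (simp add: subspace_diff)
  then have "(x - w) \<bullet> (w' - w) - (x - w') \<bullet> (w' - w) = 0" using assms w' by simp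
  then have "(w' - w) \<bullet> (w' - w) = 0" by (simp add: inner_diff_left)
  then show "w' = w" by simp
qed

lemma
  assumes V: "subspace V"
  shows orth_proj_mem: "orth_proj V x \<in> V"
    and orth_proj_orthogonal: "u \<in> V \<Longrightarrow> (x - orth_proj V x) \<bullet> u = 0"
proof -
  obtain y z where "y \<in> span V" and z: "\<And>w. w \<in> span V \<Longrightarrow> orthogonal z w" and x: "x = y + z"
    using orthogonal_subspace_decomp_exists by metis
  moreover have "span V = V" using V by (simp add: span_eq_iff)
  ultimately have y: "y \<in> V" and perp: "\<And>u. u \<in> V \<Longrightarrow> (x - y) \<bullet> u = 0"
    by (auto simp: orthogonal_def)
  have "orth_proj V x = y" by (rule orth_proj_unique[OF V y perp])
  then show "orth_proj V x \<in> V" "u \<in> V \<Longrightarrow> (x - orth_proj V x) \<bullet> u = 0"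
    using y perp by auto
qed

lemma linear_orth_proj:
  assumes V: "subspace V"
  shows "linear (orth_proj V)"
proof (rule linearI)
  note mem = orth_proj_mem[OF V] and perp = orth_proj_orthogonal[OF V]
  show "orth_proj V (x + y) = orth_proj V x + orth_proj V y" for x y
  proof (rule orth_proj_unique[OF V])
    fix u assume "u \<in> V"
    then show "(x + y - (orth_proj V x + orth_proj V y)) \<bullet> u = 0"
      using perp[of u x] perp[of u y] by (simp add: inner_simps)
  qed (intro subspace_add V mem)
  show "orth_proj V (c *\<^sub>R x) = c *\<^sub>R orth_proj V x" for c x
  proof (rule orth_proj_unique[OF V])
    fix u assume "u \<in> V"
    then show "(c *\<^sub>R x - c *\<^sub>R orth_proj V x) \<bullet> u = 0"
      using perp[of u x] by (simp flip: scaleR_diff_right)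
  qed (intro subspace_scale V mem)
qed

text \<open>The maximum of the quadratic form over the unit sphere of an invariant subspace is
  attained at an eigenvector.\<close>

lemma max_eigenvector:
  fixes A :: "'a::euclidean_space \<Rightarrow> 'a"
  assumes A: "linear A" and sym: "\<And>u v. u \<bullet> A v = A u \<bullet> v"
    and V: "subspace V" and nontriv: "V \<noteq> {0}" and inv: "\<And>v. v \<in> V \<Longrightarrow> A v \<in> V"
  obtains u l where "u \<in> V" "norm u = 1" "A u = l *\<^sub>R u" "\<And>w. w \<in> V \<Longrightarrow> w \<bullet> A w \<le> l * (norm w)\<^sup>2"
proof -
  define K where "K = sphere 0 1 \<inter> V"
  have "compact K" unfolding K_def by (intro compact_Int_closed compact_sphere closed_subspace V)
  moreover obtain v where v: "v \<in> V" "v \<noteq> 0" using nontriv V subspace_0 by blast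
  then have "sgn v \<in> K" by (simp add: K_def sgn_div_norm subspace_scale[OF V])
  then have "K \<noteq> {}" by blast
  moreover have "continuous_on K (\<lambda>w. w \<bullet> A w)"
    using A by (intro continuous_intros linear_continuous_on linear_conv_bounded_linear[THEN iffD1])
  ultimately obtain u where u: "u \<in> K" and max: "\<And>w. w \<in> K \<Longrightarrow> w \<bullet> A w \<le> u \<bullet> A u"
    using continuous_attains_sup[of K "\<lambda>w. w \<bullet> A w"] by blast
  define l where "l = u \<bullet> A u"
  have uV: "u \<in> V" and nu: "norm u = 1" using u by (auto simp: K_def)
  have le: "w \<bullet> A w \<le> l * (norm w)\<^sup>2" if "w \<in> V" for w
  proof (cases "w = 0")
    case False
    have "sgn w \<in> K" using that False by (simp add: K_def norm_sgn sgn_div_norm subspace_scale[OF V])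
    then have "sgn w \<bullet> A (sgn w) \<le> l" using max l_def by blast
    then have "w \<bullet> A w / (norm w)\<^sup>2 \<le> l"
      by (simp add: sgn_div_norm linear_scale[OF A] power2_eq_square divide_inverse mult_ac)
    then show ?thesis using False by (simp add: field_simps)
  qed (simp add: linear_0[OF A])
  define h where "h = l *\<^sub>R u - A u"
  have hV: "h \<in> V" unfolding h_def by (intro subspace_diff subspace_scale V uV inv)
  define c where "c = h \<bullet> h"
  define d where "d = l * (h \<bullet> h) - h \<bullet> A h"
  have d: "0 \<le> d" using le[OF hV] by (simp add: d_def power2_norm_eq_inner)
  \<comment> \<open>The form \<open>l|w|\<^sup>2 - w \<bullet> A w\<close> is nonnegative on \<open>V\<close> and vanishes at \<open>u\<close>; its first variation in
    the direction \<open>h\<close> is \<open>2c\<close>, hence \<open>c = 0\<close>.\<close>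
  have quad: "0 \<le> 2 * t * c + t\<^sup>2 * d" for t
  proof -
    have "u + t *\<^sub>R h \<in> V" by (intro subspace_add subspace_scale V uV hV)
    from le[OF this]
    have "0 \<le> l * ((u + t *\<^sub>R h) \<bullet> (u + t *\<^sub>R h)) - (u + t *\<^sub>R h) \<bullet> A (u + t *\<^sub>R h)"
      by (simp add: power2_norm_eq_inner)
    also have "\<dots> = (l * (u \<bullet> u) - u \<bullet> A u) + 2 * t * (l * (h \<bullet> u) - h \<bullet> A u) + t\<^sup>2 * d"
      using sym[of h u]
      by (simp add: linear_add[OF A] linear_scale[OF A] inner_simps d_def power2_eq_square
          algebra_simps inner_commute)
    also have "l * (u \<bullet> u) - u \<bullet> A u = 0" using nu by (simp add: l_def norm_eq_1)
    also have "l * (h \<bullet> u) - h \<bullet> A u = c" by (simp add: c_def h_def inner_simps)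
    finally show ?thesis by simp
  qed
  have "c = 0"
  proof (rule ccontr)
    assume "c \<noteq> 0"
    \<comment> \<open>The step \<open>t = -q\<close> makes the quadratic negative, whatever \<open>d \<ge> 0\<close> is.\<close>
    define q where "q = c / (d + 1)"
    have c: "c = q * (d + 1)" and q: "q \<noteq> 0" using d \<open>c \<noteq> 0\<close> by (auto simp: q_def)
    have "0 \<le> 2 * (- q) * c + (- q)\<^sup>2 * d" by (rule quad)
    also have "\<dots> = - (q\<^sup>2 * (d + 2))" unfolding c by (simp add: algebra_simps power2_eq_square)
    finally have "q\<^sup>2 * (d + 2) \<le> 0" by simp
    moreover have "0 < q\<^sup>2 * (d + 2)" using q d by (intro mult_pos_pos) auto
    ultimately show False by simp
  qed
  then have "A u = l *\<^sub>R u" by (simp add: c_def h_def)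
  with that[OF uV nu] le show thesis by blast
qed

lemma abs_max_eigenvector:
  fixes A :: "'a::euclidean_space \<Rightarrow> 'a"
  assumes A: "linear A" and sym: "\<And>u v. u \<bullet> A v = A u \<bullet> v"
    and V: "subspace V" and nontriv: "V \<noteq> {0}" and inv: "\<And>v. v \<in> V \<Longrightarrow> A v \<in> V"
  obtains u l where "u \<in> V" "norm u = 1" "A u = l *\<^sub>R u"
    "\<And>w. w \<in> V \<Longrightarrow> \<bar>w \<bullet> A w\<bar> \<le> \<bar>l\<bar> * (norm w)\<^sup>2"
proof -
  obtain u l where u: "u \<in> V" "norm u = 1" "A u = l *\<^sub>R u"
    and l: "\<And>w. w \<in> V \<Longrightarrow> w \<bullet> A w \<le> l * (norm w)\<^sup>2"
    using max_eigenvector[OF assms] by blast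
  have A': "linear (\<lambda>v. - A v)" using A by (rule linear_compose_neg)
  have sym': "u \<bullet> - A v = - A u \<bullet> v" for u v by (simp add: sym)
  have inv': "- A v \<in> V" if "v \<in> V" for v using that inv V by (simp add: subspace_neg)
  obtain u' l' where u': "u' \<in> V" "norm u' = 1" "- A u' = l' *\<^sub>R u'"
    and l': "\<And>w. w \<in> V \<Longrightarrow> w \<bullet> - A w \<le> l' * (norm w)\<^sup>2"
    using max_eigenvector[OF A' sym' V nontriv inv'] by blast
  have bound: "\<bar>w \<bullet> A w\<bar> \<le> \<bar>k\<bar> * (norm w)\<^sup>2" if "w \<in> V" "l \<le> \<bar>k\<bar>" "l' \<le> \<bar>k\<bar>" for w k
  proof -
    have "l * (norm w)\<^sup>2 \<le> \<bar>k\<bar> * (norm w)\<^sup>2" "l' * (norm w)\<^sup>2 \<le> \<bar>k\<bar> * (norm w)\<^sup>2"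
      using that by (auto intro!: mult_right_mono)
    then show ?thesis using l[OF that(1)] l'[OF that(1)] by simp
  qed
  have eig': "A u' = (- l') *\<^sub>R u'" using u'(3) by (metis minus_minus scaleR_minus_left)
  show thesis
  proof (cases "l' \<le> l")
    case True
    show thesis by (rule that[OF u]) (rule bound, use True in auto)
  next
    case False
    show thesis by (rule that[OF u'(1,2) eig']) (rule bound, use False in auto)
  qed
qed

lemma finite_eigenvalues:
  fixes A :: "'a::euclidean_space \<Rightarrow> 'a"
  assumes sym: "\<And>u v. u \<bullet> A v = A u \<bullet> v"
  shows "finite {l. \<exists>v. v \<noteq> 0 \<and> A v = l *\<^sub>R v}" (is "finite ?E")
proof -
  define e where "e l = (SOME v. v \<noteq> 0 \<and> A v = l *\<^sub>R v)" for l
  have e: "e l \<noteq> 0" "A (e l) = l *\<^sub>R e l" if "l \<in> ?E" for l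
    using that someI_ex[of "\<lambda>v. v \<noteq> 0 \<and> A v = l *\<^sub>R v"] unfolding e_def by auto
  have orth: "e k \<bullet> e l = 0" if "k \<in> ?E" "l \<in> ?E" "k \<noteq> l" for k l
    using sym[of "e k" "e l"] that(3) e(2)[OF that(1)] e(2)[OF that(2)] by simp
  have inj: "inj_on e ?E"
  proof (rule inj_onI)
    fix k l assume kl: "k \<in> ?E" "l \<in> ?E" "e k = e l"
    then have "e k \<bullet> e l \<noteq> 0" using e(1)[OF kl(1)] by simp
    then show "k = l" using orth[OF kl(1,2)] by blast
  qed
  have "pairwise orthogonal (e ` ?E)"
    using orth by (fastforce simp: pairwise_def orthogonal_def)
  moreover have "0 \<notin> e ` ?E" using e(1) by fastforce
  ultimately have "independent (e ` ?E)" by (rule pairwise_orthogonal_independent)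
  then show ?thesis using inj finite_imageD independent_imp_finite by blast
qed

lemma lambda_min_le_eigenvalue:
  fixes A :: "'a::euclidean_space \<Rightarrow> 'a"
  assumes sym: "\<And>u v. u \<bullet> A v = A u \<bullet> v" and "v \<noteq> 0" "A v = l *\<^sub>R v"
  shows "lambda_min A \<le> l"
  unfolding lambda_min_def using assms(2,3) by (intro Min_le finite_eigenvalues sym) auto

lemma lambda_min_le_quadratic_form:
  fixes A :: "'a::euclidean_space \<Rightarrow> 'a"
  assumes A: "linear A" and sym: "\<And>u v. u \<bullet> A v = A u \<bullet> v"
  shows "lambda_min A * (norm w)\<^sup>2 \<le> w \<bullet> A w"
proof -
  have A': "linear (\<lambda>v. - A v)" using A by (rule linear_compose_neg)
  have sym': "u \<bullet> - A v = - A u \<bullet> v" for u v by (simp add: sym)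
  have "(UNIV :: 'a set) \<noteq> {0}" by (metis UNIV_I nonzero_Basis singletonD SOME_Basis)
  then obtain u l where u: "norm u = 1" "- A u = l *\<^sub>R u"
    and le: "\<And>w. w \<bullet> - A w \<le> l * (norm w)\<^sup>2"
    using max_eigenvector[OF A' sym' subspace_UNIV] by (metis UNIV_I)
  have "lambda_min A \<le> - l"
  proof (rule lambda_min_le_eigenvalue[OF sym])
    show "u \<noteq> 0" using u(1) by auto
    show "A u = (- l) *\<^sub>R u" using u(2) by (metis minus_minus scaleR_minus_left)
  qed
  then have "lambda_min A * (norm w)\<^sup>2 \<le> - l * (norm w)\<^sup>2" by (intro mult_right_mono) auto
  then show ?thesis using le[of w] by simp
qed

lemma lambda_min_eigenvalue:
  fixes A :: "'a::euclidean_space \<Rightarrow> 'a"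
  assumes A: "linear A" and sym: "\<And>u v. u \<bullet> A v = A u \<bullet> v"
  obtains v where "v \<noteq> 0" "A v = lambda_min A *\<^sub>R v"
proof -
  have "(UNIV :: 'a set) \<noteq> {0}" by (metis UNIV_I nonzero_Basis singletonD SOME_Basis)
  then obtain u l where "norm u = 1" "A u = l *\<^sub>R u"
    using max_eigenvector[OF A sym subspace_UNIV] by (metis UNIV_I)
  moreover from this have "u \<noteq> 0" by auto
  ultimately have "{l. \<exists>v. v \<noteq> 0 \<and> A v = l *\<^sub>R v} \<noteq> {}" by blast
  then have "lambda_min A \<in> {l. \<exists>v. v \<noteq> 0 \<and> A v = l *\<^sub>R v}"
    unfolding lambda_min_def by (intro Min_in finite_eigenvalues sym)
  then show thesis using that by blast
qed

section \<open>Singular values of a symmetric operator\<close>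

text \<open>The sum that defines the list of singular values ranges over a finite set, because the
  eigenvalues of \<open>A\<^sup>* A\<close> are finitely many; hence it is not the default value of an infinite sum.\<close>

lemma set_singular_values:
  fixes A :: "'a::euclidean_space \<Rightarrow> 'b::euclidean_space"
  assumes A: "linear A"
  shows "set (singular_values A) = {s. 0 \<le> s \<and> gram_eigenspace A s \<noteq> {0}}" (is "_ = ?S")
proof -
  have sym: "u \<bullet> adjoint A (A v) = adjoint A (A u) \<bullet> v" for u v
    using adjoint_works[OF A] by (simp add: inner_commute)
  have zero: "0 \<in> gram_eigenspace A s" for s
    by (simp add: gram_eigenspace_def linear_0[OF A] linear_0[OF adjoint_linear[OF A]])
  then have nz: "\<exists>v. v \<noteq> 0 \<and> v \<in> gram_eigenspace A s" if "gram_eigenspace A s \<noteq> {0}" for s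
    using that by blast
  have "(\<lambda>s. s\<^sup>2) ` ?S \<subseteq> {l. \<exists>v. v \<noteq> 0 \<and> adjoint A (A v) = l *\<^sub>R v}"
    using nz by (fastforce simp: gram_eigenspace_def)
  then have "finite ((\<lambda>s. s\<^sup>2) ` ?S)"
    using finite_eigenvalues[of "\<lambda>v. adjoint A (A v)", OF sym] finite_subset by blast
  moreover have "inj_on (\<lambda>s::real. s\<^sup>2) ?S" by (auto intro!: inj_onI)
  ultimately have fin: "finite ?S" using finite_imageD by blast
  have "dim (gram_eigenspace A s) > 0" if "s \<in> ?S" for s
    using nz[of s] that dim_eq_0[of "gram_eigenspace A s"] by blast
  then have "(\<Union>s\<in>?S. set_mset (replicate_mset (dim (gram_eigenspace A s)) s)) = ?S"
    by (intro equalityI subsetI) (auto simp: zero split: if_splits)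
  then show ?thesis
    unfolding singular_values_def by (simp only: set_rev set_sorted_list_of_multiset set_mset_sum[OF fin])
qed

lemma sorted_singular_values: "sorted_wrt (\<ge>) (singular_values A)"
  unfolding singular_values_def by (simp add: sorted_wrt_rev)

text \<open>In a decreasing list the entry behind all copies of the maximum bounds every smaller entry.
  Its index, counted from 0, is the multiplicity of the maximum.\<close>

lemma decreasing_list_nth:
  fixes xs :: "'a::linorder list"
  assumes sorted: "sorted_wrt (\<ge>) xs" and s: "s \<in> set xs" "s \<noteq> xs ! 0"
  shows "s \<le> xs ! count_list xs (xs ! 0)" and "xs ! count_list xs (xs ! 0) \<le> xs ! 0"
proof -
  define p where "p = count_list xs (xs ! 0)"
  have ge: "xs ! j \<le> xs ! i" if "i \<le> j" "j < length xs" for i j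
    using sorted that by (cases "i = j") (auto simp: sorted_wrt_iff_nth_less)
  obtain j where j: "j < length xs" "xs ! j = s" using s(1) by (auto simp: in_set_conv_nth)
  have "s < xs ! 0" using ge[of 0 j] j s(2) by simp
  have "xs ! 0 \<notin> set (drop j xs)"
  proof
    assume "xs ! 0 \<in> set (drop j xs)"
    then obtain i where "i < length (drop j xs)" "drop j xs ! i = xs ! 0"
      by (auto simp: in_set_conv_nth)
    then have "xs ! 0 \<le> s" using ge[of j "j + i"] j by auto
    then show False using \<open>s < xs ! 0\<close> by simp
  qed
  then have "p = count_list (take j xs) (xs ! 0)"
    unfolding p_def by (metis append_take_drop_id count_list_append count_list_0_iff add.right_neutral)
  also have "\<dots> \<le> j" using count_le_length[of "take j xs"] j by (metis length_take min.absorb4)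
  finally have "p \<le> j" .
  then show "s \<le> xs ! count_list xs (xs ! 0)" "xs ! count_list xs (xs ! 0) \<le> xs ! 0"
    using ge[of p j] ge[of 0 p] j unfolding p_def by auto
qed

context
  fixes A :: "'a::euclidean_space \<Rightarrow> 'a"
  assumes A: "linear A" and sym: "\<And>u v. u \<bullet> A v = A u \<bullet> v"
begin

lemma adjoint_symmetric: "adjoint A = A"
  using sym by (intro adjoint_unique) (simp add: inner_commute)

lemma abs_eigenvalue_in_singular_values:
  assumes "v \<noteq> 0" "A v = l *\<^sub>R v"
  shows "\<bar>l\<bar> \<in> set (singular_values A)"
proof -
  have "v \<in> gram_eigenspace A \<bar>l\<bar>"
    using assms(2) by (simp add: gram_eigenspace_def adjoint_symmetric linear_scale[OF A] power2_eq_square)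
  then show ?thesis using assms(1) by (auto simp: set_singular_values[OF A])
qed

lemma singular_value_le_sigma_max:
  assumes "s \<in> set (singular_values A)"
  shows "s \<le> sigma_max A"
proof -
  obtain j where "j < length (singular_values A)" "singular_values A ! j = s"
    using assms by (auto simp: in_set_conv_nth)
  then show ?thesis
    using sorted_singular_values[of A] unfolding sigma_max_def singular_value_def
    by (cases "j = 0") (auto simp: sorted_wrt_iff_nth_less)
qed

lemma abs_quadratic_form_le_sigma_max: "\<bar>w \<bullet> A w\<bar> \<le> sigma_max A * (norm w)\<^sup>2"
proof -
  have "(UNIV :: 'a set) \<noteq> {0}" by (metis UNIV_I nonzero_Basis singletonD SOME_Basis)
  then obtain u l where u: "norm u = 1" "A u = l *\<^sub>R u"
    and le: "\<And>w. \<bar>w \<bullet> A w\<bar> \<le> \<bar>l\<bar> * (norm w)\<^sup>2"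
    using abs_max_eigenvector[OF A sym subspace_UNIV] by (metis UNIV_I)
  have "u \<noteq> 0" using u(1) by auto
  then have "\<bar>l\<bar> \<le> sigma_max A"
    using u(2) abs_eigenvalue_in_singular_values singular_value_le_sigma_max by blast
  then have "\<bar>l\<bar> * (norm w)\<^sup>2 \<le> sigma_max A * (norm w)\<^sup>2" by (intro mult_right_mono) auto
  then show ?thesis using le[of w] by simp
qed

lemma sigma_max_le_onorm: "sigma_max A \<le> onorm A"
proof -
  obtain u l where "norm u = 1" "A u = l *\<^sub>R u"
    using abs_max_eigenvector[OF A sym subspace_UNIV] by (metis UNIV_I nonzero_Basis singletonD SOME_Basis)
  then have "set (singular_values A) \<noteq> {}"
    using abs_eigenvalue_in_singular_values[of u l] by force
  then have "sigma_max A \<in> set (singular_values A)"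
    by (simp add: sigma_max_def singular_value_def)
  then obtain v where v: "v \<noteq> 0" "A (A v) = (sigma_max A)\<^sup>2 *\<^sub>R v" and nn: "0 \<le> sigma_max A"
    using linear_0[OF A]
    by (force simp: set_singular_values[OF A] gram_eigenspace_def adjoint_symmetric)
  have "(norm (A v))\<^sup>2 = v \<bullet> A (A v)" by (simp add: sym power2_norm_eq_inner)
  also have "\<dots> = (sigma_max A * norm v)\<^sup>2"
    by (simp add: v(2) power2_norm_eq_inner power_mult_distrib)
  finally have "norm (A v) = sigma_max A * norm v" using nn by (simp add: power2_eq_iff_nonneg)
  moreover have "norm (A v) \<le> onorm A * norm v" using A by (intro onorm linear_conv_bounded_linear[THEN iffD1])
  ultimately show ?thesis using v(1) by simp
qed

lemma dominant_subspace_invariant: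
  assumes "v \<in> dominant_subspace A"
  shows "A v \<in> dominant_subspace A"
  using assms unfolding dominant_subspace_def
proof (induction rule: span_induct_alt)
  case base
  then show ?case by (simp add: linear_0[OF A] span_zero)
next
  case (step c x y)
  then obtain l where "A x = l *\<^sub>R x" by blast
  then have "A (c *\<^sub>R x + y) = (c * l) *\<^sub>R x + A y"
    by (simp add: linear_add[OF A] linear_scale[OF A])
  then show ?case using step by (simp only: span_add span_scale span_base)
qed

text \<open>On the orthogonal complement of the dominant subspace the quadratic form is controlled by
  the next singular value.  A nonzero complement also guarantees that there is such a value.\<close>

lemma quadratic_form_orthogonal_dominant:
  assumes nz: "z \<noteq> 0" and z: "\<And>v. v \<in> dominant_subspace A \<Longrightarrow> v \<bullet> z = 0"
  defines "s \<equiv> singular_value A (sigma_max_multiplicity A + 1)"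
  shows "s \<le> sigma_max A" and "\<bar>z \<bullet> A z\<bar> \<le> s * (norm z)\<^sup>2"
proof -
  define V where "V = {z. \<forall>v \<in> dominant_subspace A. v \<bullet> z = 0}"
  have zV: "z \<in> V" using z by (simp add: V_def)
  have V: "subspace V" by (auto simp: V_def subspace_def inner_simps)
  have nontriv: "V \<noteq> {0}" using nz zV by blast
  have inv: "A v \<in> V" if "v \<in> V" for v
    using that dominant_subspace_invariant by (auto simp: V_def sym)
  obtain u l where u: "u \<in> V" "norm u = 1" "A u = l *\<^sub>R u"
    and le: "\<And>w. w \<in> V \<Longrightarrow> \<bar>w \<bullet> A w\<bar> \<le> \<bar>l\<bar> * (norm w)\<^sup>2"
    using abs_max_eigenvector[OF A sym V nontriv inv] by metis
  have "u \<noteq> 0" using u(2) by auto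
  then have mem: "\<bar>l\<bar> \<in> set (singular_values A)"
    using u(3) abs_eigenvalue_in_singular_values by blast
  have "\<bar>l\<bar> \<noteq> sigma_max A"
  proof
    assume "\<bar>l\<bar> = sigma_max A"
    then have "u \<in> dominant_subspace A"
      unfolding dominant_subspace_def using u(3) by (intro span_base) auto
    then have "u \<bullet> u = 0" using u(1) by (auto simp: V_def)
    then show False using \<open>u \<noteq> 0\<close> by simp
  qed
  then have "\<bar>l\<bar> \<le> s" and s: "s \<le> sigma_max A"
    using decreasing_list_nth[OF sorted_singular_values mem]
    by (auto simp: s_def singular_value_def sigma_max_def sigma_max_multiplicity_def)
  show "s \<le> sigma_max A" by (rule s)
  have "\<bar>l\<bar> * (norm z)\<^sup>2 \<le> s * (norm z)\<^sup>2" using \<open>\<bar>l\<bar> \<le> s\<close> by (intro mult_right_mono) auto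
  then show "\<bar>z \<bullet> A z\<bar> \<le> s * (norm z)\<^sup>2" using le[OF zV] by simp
qed

text \<open>A subspace that stays away from the dominant directions sees a smaller form: a unit vector
  \<open>w \<in> T\<close> has dominant component \<open>v\<close> with \<open>|v| \<le> 1 - \<epsilon>\<close>, so that at least \<open>2 \<epsilon> - \<epsilon>\<^sup>2\<close> of its
  squared length lies in the complement.\<close>

lemma quadratic_form_on_misaligned_subspace:
  assumes T: "subspace T" and wT: "w \<in> T" and nw: "norm w = 1"
    and eps: "0 < \<epsilon>" "\<epsilon> \<le> 1"
    and angle: "\<And>v. v \<in> dominant_subspace A \<Longrightarrow> norm v = 1 \<Longrightarrow> norm (orth_proj T v) \<le> 1 - \<epsilon>"
  defines "s \<equiv> singular_value A (sigma_max_multiplicity A + 1)"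
  shows "s \<le> sigma_max A"
    and "\<bar>w \<bullet> A w\<bar> \<le> sigma_max A - (sigma_max A - s) * (2 * \<epsilon> - \<epsilon>\<^sup>2)"
proof -
  let ?D = "dominant_subspace A"
  have D: "subspace ?D" by (simp add: dominant_subspace_def)
  define v where "v = orth_proj ?D w"
  define z where "z = w - v"
  have vD: "v \<in> ?D" unfolding v_def by (rule orth_proj_mem[OF D])
  have perp: "u \<bullet> z = 0" if "u \<in> ?D" for u
    unfolding z_def v_def using orth_proj_orthogonal[OF D that] by (simp add: inner_commute)
  have w: "w = v + z" by (simp add: z_def)
  have pyth: "(norm v)\<^sup>2 + (norm z)\<^sup>2 = 1"
    using nw perp[OF vD] unfolding w by (simp add: norm_eq_1 power2_norm_eq_inner inner_simps inner_commute)
  have nv: "norm v \<le> 1 - \<epsilon>"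
  proof (cases "v = 0")
    case False
    have "sgn v \<in> ?D" using vD D by (simp add: sgn_div_norm subspace_scale)
    then have a: "norm (orth_proj T (sgn v)) \<le> 1 - \<epsilon>" using False by (intro angle) (auto simp: norm_sgn)
    have "norm v = sgn v \<bullet> v" using False
      by (simp add: sgn_div_norm power2_norm_eq_inner[symmetric] power2_eq_square)
    also have "\<dots> = sgn v \<bullet> w" using perp[OF \<open>sgn v \<in> ?D\<close>] by (simp add: w inner_simps)
    also have "\<dots> = orth_proj T (sgn v) \<bullet> w"
      using orth_proj_orthogonal[OF T wT, of "sgn v"] by (simp add: inner_simps)
    also have "\<dots> \<le> norm (orth_proj T (sgn v)) * norm w" by (rule norm_cauchy_schwarz)
    finally show ?thesis using a nw by simp
  qed (use eps in auto)
  then have "(norm v)\<^sup>2 \<le> (1 - \<epsilon>)\<^sup>2" by (intro power_mono) auto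
  then have z2: "2 * \<epsilon> - \<epsilon>\<^sup>2 \<le> (norm z)\<^sup>2" using pyth by (simp add: power2_diff)
  have "norm v < 1" using nv eps by simp
  then have "(norm v)\<^sup>2 < 1" by (simp add: power_less_one_iff)
  then have "z \<noteq> 0" using pyth by auto
  note s = quadratic_form_orthogonal_dominant[OF this perp, folded s_def]
  show "s \<le> sigma_max A" by (rule s(1))
  have "v \<bullet> A z = 0" using dominant_subspace_invariant[OF vD] perp by (simp add: sym)
  moreover have "z \<bullet> A v = 0"
    using perp[OF dominant_subspace_invariant[OF vD]] by (subst inner_commute)
  ultimately have "w \<bullet> A w = v \<bullet> A v + z \<bullet> A z"
    by (simp add: w linear_add[OF A] inner_simps)
  then have "\<bar>w \<bullet> A w\<bar> \<le> sigma_max A * (norm v)\<^sup>2 + s * (norm z)\<^sup>2"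
    using abs_quadratic_form_le_sigma_max[of v] s(2) by linarith
  also have "\<dots> = sigma_max A - (sigma_max A - s) * (norm z)\<^sup>2"
    using pyth by (simp add: algebra_simps flip: distrib_left)
  also have "\<dots> \<le> sigma_max A - (sigma_max A - s) * (2 * \<epsilon> - \<epsilon>\<^sup>2)"
    using z2 s(1) by (intro diff_left_mono mult_left_mono) auto
  finally show "\<bar>w \<bullet> A w\<bar> \<le> sigma_max A - (sigma_max A - s) * (2 * \<epsilon> - \<epsilon>\<^sup>2)" .
qed

end

section \<open>Quadratic and bilinear forms\<close>

lemma inner_bilinear_le_bilinear_norm:
  fixes B :: "'a::euclidean_space \<Rightarrow> 'a \<Rightarrow> 'b::euclidean_space"
  assumes B: "bilinear B"
  shows "\<bar>g \<bullet> B y y\<bar> \<le> bilinear_norm B * norm g * (norm y)\<^sup>2"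
proof (cases "y = 0 \<or> g = 0")
  case True
  then show ?thesis by (auto simp: bilinear_lzero[OF B])
next
  case False
  obtain K where K: "\<And>u v. norm (B u v) \<le> K * norm u * norm v" using bilinear_bounded[OF B] by blast
  have bdd: "bdd_above ((\<lambda>(u, v, w). w \<bullet> B u v) ` (sphere 0 1 \<times> sphere 0 1 \<times> sphere 0 1))"
  proof (rule bdd_aboveI2, clarsimp)
    fix u v :: 'a and w :: 'b assume 1: "norm u = 1" "norm v = 1" "norm w = 1"
    show "w \<bullet> B u v \<le> K" using norm_cauchy_schwarz[of w "B u v"] K[of u v] 1 by simp
  qed
  have unit: "w \<bullet> B (sgn y) (sgn y) \<le> bilinear_norm B" if "norm w = 1" for w
    unfolding bilinear_norm_def
    by (rule cSUP_upper2[OF bdd, of "(sgn y, sgn y, w)"]) (use that False in \<open>auto simp: norm_sgn\<close>)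
  have "w \<bullet> B y y \<le> bilinear_norm B * (norm y)\<^sup>2" if "norm w = 1" for w
  proof -
    have "B (norm y *\<^sub>R sgn y) (norm y *\<^sub>R sgn y) = (norm y)\<^sup>2 *\<^sub>R B (sgn y) (sgn y)"
      by (simp only: bilinear_lmul[OF B] bilinear_rmul[OF B] power2_eq_square scaleR_scaleR)
    moreover have "norm y *\<^sub>R sgn y = y" using False by (simp add: sgn_div_norm)
    ultimately have "B y y = (norm y)\<^sup>2 *\<^sub>R B (sgn y) (sgn y)" by simp
    then show ?thesis using mult_left_mono[OF unit[OF that], of "(norm y)\<^sup>2"]
      by (simp add: mult.commute)
  qed
  from this[of "sgn g"] this[of "- sgn g"]
  have "\<bar>sgn g \<bullet> B y y\<bar> \<le> bilinear_norm B * (norm y)\<^sup>2" using False by (auto simp: norm_sgn)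
  moreover have "g \<bullet> B y y = norm g * (sgn g \<bullet> B y y)" using False by (simp add: sgn_div_norm)
  ultimately show ?thesis
    using mult_left_mono[of "\<bar>sgn g \<bullet> B y y\<bar>" "bilinear_norm B * (norm y)\<^sup>2" "norm g"]
    by (simp add: abs_mult mult_ac)
qed

text \<open>Polarisation: a symmetric form is bounded off the diagonal by its bound on the diagonal.
  The norm used here is \<open>|D y|\<close> for an injective linear map \<open>D\<close>.\<close>

lemma symmetric_form_polarization:
  fixes B :: "'a::real_vector \<Rightarrow> 'a \<Rightarrow> real" and D :: "'a \<Rightarrow> 'b::real_inner"
  assumes B: "bilinear B" and sym: "\<And>u v. B u v = B v u"
    and D: "linear D" and inj: "\<And>y. D y = 0 \<Longrightarrow> y = 0"
    and diag: "\<And>y. \<bar>B y y\<bar> \<le> c * (norm (D y))\<^sup>2"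
  shows "\<bar>B u v\<bar> \<le> c * norm (D u) * norm (D v)"
proof (cases "u = 0 \<or> v = 0")
  case True
  then show ?thesis
    by (auto simp: bilinear_lzero[OF B] bilinear_rzero[OF B] linear_0[OF D])
next
  case False
  define a where "a = u /\<^sub>R norm (D u)"
  define b where "b = v /\<^sub>R norm (D v)"
  have pos: "norm (D u) > 0" "norm (D v) > 0" using False inj by auto
  have u: "u = norm (D u) *\<^sub>R a" and v: "v = norm (D v) *\<^sub>R b" using pos by (auto simp: a_def b_def)
  have unit: "norm (D a) = 1" "norm (D b) = 1"
    using pos by (auto simp: a_def b_def linear_scale[OF D])
  have "4 * B a b = B (a + b) (a + b) - B (a - b) (a - b)"
    by (simp add: bilinear_ladd[OF B] bilinear_radd[OF B] bilinear_lsub[OF B] bilinear_rsub[OF B]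
        sym[of b a])
  then have "4 * \<bar>B a b\<bar> \<le> \<bar>B (a + b) (a + b)\<bar> + \<bar>B (a - b) (a - b)\<bar>" by linarith
  also have "\<dots> \<le> c * (norm (D (a + b)))\<^sup>2 + c * (norm (D (a - b)))\<^sup>2" by (intro add_mono diag)
  also have "\<dots> = 2 * c * ((norm (D a))\<^sup>2 + (norm (D b))\<^sup>2)"
    by (simp add: linear_add[OF D] linear_diff[OF D] power2_norm_eq_inner inner_simps algebra_simps)
  finally have le: "\<bar>B a b\<bar> \<le> c" by (simp add: unit)
  have "B u v = norm (D u) * norm (D v) * B a b"
    by (subst u, subst v) (simp add: bilinear_lmul[OF B] bilinear_rmul[OF B])
  then show ?thesis
    using mult_left_mono[OF le, of "norm (D u) * norm (D v)"] by (simp add: abs_mult mult_ac)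
qed

context
  fixes A :: "'a::euclidean_space \<Rightarrow> 'a" and V :: "'a set"
  assumes A: "linear A" and sym: "\<And>u v. u \<bullet> A v = A u \<bullet> v" and V: "subspace V"
begin

lemma abs_quadratic_form_le_sigma_max_unit: "norm w = 1 \<Longrightarrow> \<bar>w \<bullet> A w\<bar> \<le> sigma_max A"
  using abs_quadratic_form_le_sigma_max[OF A sym, of w] by simp

lemma abs_quadratic_form_le_sigma_max_on:
  assumes w: "w \<in> V"
  shows "\<bar>w \<bullet> A w\<bar> \<le> sigma_max_on A V * (norm w)\<^sup>2"
proof (cases "w = 0")
  case False
  have bdd: "bdd_above ((\<lambda>w. \<bar>w \<bullet> A w\<bar>) ` {w \<in> V. norm w = 1})"
    by (intro bdd_aboveI2[of _ _ "sigma_max A"] abs_quadratic_form_le_sigma_max_unit) simp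
  have "sgn w \<in> {w \<in> V. norm w = 1}"
    using w False V by (simp add: norm_sgn) (simp add: sgn_div_norm subspace_scale)
  then have "\<bar>sgn w \<bullet> A (sgn w)\<bar> \<le> sigma_max_on A V"
    unfolding sigma_max_on_def by (rule cSUP_upper[OF _ bdd])
  moreover have "w \<bullet> A w = (norm w)\<^sup>2 * (sgn w \<bullet> A (sgn w))"
    using False by (simp add: sgn_div_norm linear_scale[OF A] power2_eq_square field_simps)
  ultimately show ?thesis
    using mult_left_mono[of "\<bar>sgn w \<bullet> A (sgn w)\<bar>" _ "(norm w)\<^sup>2"] by (simp add: abs_mult mult.commute)
qed simp

lemma sigma_max_on_le:
  assumes "V \<noteq> {0}" and "\<And>w. w \<in> V \<Longrightarrow> norm w = 1 \<Longrightarrow> \<bar>w \<bullet> A w\<bar> \<le> c"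
  shows "sigma_max_on A V \<le> c"
  unfolding sigma_max_on_def
proof (rule cSUP_least)
  obtain v where "v \<in> V" "v \<noteq> 0" using assms(1) subspace_0[OF V] by blast
  then have "sgn v \<in> {w \<in> V. norm w = 1}"
    using V by (simp add: norm_sgn) (simp add: sgn_div_norm subspace_scale)
  then show "{w \<in> V. norm w = 1} \<noteq> {}" by blast
qed (use assms(2) in auto)

lemma sigma_max_on_le_sigma_max: "V \<noteq> {0} \<Longrightarrow> sigma_max_on A V \<le> sigma_max A"
  by (intro sigma_max_on_le abs_quadratic_form_le_sigma_max_unit)

end

section \<open>The pullback metric\<close>

text \<open>The third conclusion needs the bound \<open>K\<close> as well: without it the quotients
  whose supremum is \<open>metric_form_norm\<close> might be unbounded.\<close>

lemma metric_form_norm_bound: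
  fixes R H :: "'a::euclidean_space \<Rightarrow> 'a"
  assumes pos: "\<And>y. y \<noteq> 0 \<Longrightarrow> 0 < metric_inner R y y"
    and bound: "\<And>y. \<bar>y \<bullet> H y\<bar> \<le> K * metric_inner R y y"
  shows "metric_form_norm R H \<le> K" and "0 \<le> metric_form_norm R H"
    and "y \<noteq> 0 \<Longrightarrow> \<bar>y \<bullet> H y\<bar> \<le> metric_form_norm R H * metric_inner R y y"
proof -
  have le: "\<bar>y \<bullet> H y\<bar> / metric_inner R y y \<le> K" if "y \<in> {y. y \<noteq> 0}" for y
    using that pos[of y] bound[of y] by (simp add: divide_le_eq)
  then have bdd: "bdd_above ((\<lambda>y. \<bar>y \<bullet> H y\<bar> / metric_inner R y y) ` {y. y \<noteq> 0})"
    by (rule bdd_aboveI2)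
  define b :: 'a where "b = (SOME b. b \<in> Basis)"
  have b: "b \<noteq> 0" unfolding b_def by (rule nonzero_Basis[OF SOME_Basis])
  show "metric_form_norm R H \<le> K"
    unfolding metric_form_norm_def using b le by (intro cSUP_least) auto
  have up: "\<bar>y \<bullet> H y\<bar> / metric_inner R y y \<le> metric_form_norm R H" if "y \<noteq> 0" for y
    unfolding metric_form_norm_def using that by (intro cSUP_upper bdd) simp
  show "0 \<le> metric_form_norm R H"
    using up[OF b] pos[OF b] by (meson abs_ge_zero divide_nonneg_pos order_trans)
  show "\<bar>y \<bullet> H y\<bar> \<le> metric_form_norm R H * metric_inner R y y" if "y \<noteq> 0"
    using up[OF that] pos[OF that] by (simp add: divide_le_eq)
qed

lemma metric_inner_pullback:
  assumes "C2_map \<Phi>"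
  shows "metric_inner (pullback_metric \<Phi> x) u v = deriv1 \<Phi> x u \<bullet> deriv1 \<Phi> x v"
  by (simp add: metric_inner_def pullback_metric_def adjoint_works[OF linear_deriv1[OF assms]])

lemma metric_norm_pullback:
  assumes "C2_map \<Phi>"
  shows "metric_norm (pullback_metric \<Phi> x) u = norm (deriv1 \<Phi> x u)"
  by (simp add: metric_norm_def metric_inner_pullback[OF assms] norm_eq_sqrt_inner)

lemma linear_pullback_metric:
  assumes "C2_map \<Phi>"
  shows "linear (pullback_metric \<Phi> x)"
  unfolding pullback_metric_def
  by (intro linear_compose linear_deriv1 adjoint_linear assms)

lemma pullback_metric_symmetric:
  assumes "C2_map \<Phi>"
  shows "u \<bullet> pullback_metric \<Phi> x v = pullback_metric \<Phi> x u \<bullet> v"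
  using metric_inner_pullback[OF assms, of x u v] metric_inner_pullback[OF assms, of x v u]
  by (simp add: metric_inner_def inner_commute)

text \<open>The Riemannian gradient represents \<open>dF\<close> with respect to a nondegenerate metric.\<close>

lemma metric_inner_riemannian_gradient:
  fixes F :: "'a::euclidean_space \<Rightarrow> real" and \<Phi> :: "'a \<Rightarrow> 'b::euclidean_space"
  assumes \<Phi>: "C2_map \<Phi>" and inj: "\<And>y. deriv1 \<Phi> x y = 0 \<Longrightarrow> y = 0" and F: "C2_map F"
  shows "metric_inner (pullback_metric \<Phi> x) (riemannian_gradient (pullback_metric \<Phi>) F x) v
           = deriv1 F x v"
proof -
  let ?R = "pullback_metric \<Phi> x"
  note lin = linear_pullback_metric[OF \<Phi>, of x] and sym = pullback_metric_symmetric[OF \<Phi>, of _ x]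
  have zero: "y = 0" if "?R y = 0" for y
    using metric_inner_pullback[OF \<Phi>, of x y y] that inj by (simp add: metric_inner_def)
  then have injR: "inj ?R" using linear_injective_0[OF lin] by blast
  then obtain g where g: "?R g = gradient F x"
    using linear_injective_imp_surjective[OF lin] by (metis surjD)
  have g_rep: "metric_inner ?R g v = deriv1 F x v" for v
    using g inner_gradient[OF C2_map_has_derivative[OF F], of x v]
    by (simp add: metric_inner_def sym)
  have "riemannian_gradient (pullback_metric \<Phi>) F x = g"
    unfolding riemannian_gradient_def
  proof (rule the_equality)
    show "\<forall>v. metric_inner ?R g v = deriv1 F x v" using g_rep by blast
    fix g' assume "\<forall>v. metric_inner ?R g' v = deriv1 F x v"
    then have "\<forall>v. ?R g' \<bullet> v = ?R g \<bullet> v" using g_rep by (simp add: metric_inner_def sym)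
    then have "?R g' = ?R g" by (simp add: vector_eq_rdot)
    then show "g' = g" using injR by (simp add: inj_eq)
  qed
  then show ?thesis by (simp add: g_rep)
qed

text \<open>A bound on the coordinate Hessian, as a bilinear form measured in the metric, integrates
  along curves to the Lipschitz property.\<close>

lemma riemannian_gradient_lipschitz_on_pullback:
  fixes F :: "'a::euclidean_space \<Rightarrow> real" and \<Phi> :: "'a \<Rightarrow> 'b::euclidean_space"
  assumes \<Phi>: "C2_map \<Phi>" and inj: "\<And>x y. deriv1 \<Phi> x y = 0 \<Longrightarrow> y = 0" and F: "C2_map F"
    and \<beta>: "0 \<le> \<beta>"
    and bound: "\<And>x u v. x \<in> U \<Longrightarrow>
          \<bar>deriv2 F x u v\<bar> \<le> \<beta> * norm (deriv1 \<Phi> x u) * norm (deriv1 \<Phi> x v)"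
  shows "riemannian_gradient_lipschitz_on \<beta> U (pullback_metric \<Phi>) F"
  unfolding riemannian_gradient_lipschitz_on_def
proof (intro conjI allI impI)
  show "0 \<le> \<beta>" by (rule \<beta>)
  fix \<gamma> :: "real \<Rightarrow> 'a" and w :: 'a
  assume "\<gamma> C1_differentiable_on {0..1} \<and> \<gamma> ` {0..1} \<subseteq> U"
  then have \<gamma>: "\<And>t. t \<in> {0..1} \<Longrightarrow> \<gamma> differentiable (at t)" and \<gamma>U: "\<And>t. t \<in> {0..1} \<Longrightarrow> \<gamma> t \<in> U"
    and cont': "continuous_on {0..1} (\<lambda>t. vector_derivative \<gamma> (at t))"
    by (auto simp: C1_differentiable_on_eq)
  define \<gamma>' where "\<gamma>' t = vector_derivative \<gamma> (at t)" for t
  have d\<gamma>: "(\<gamma> has_vector_derivative \<gamma>' t) (at t within {0..1})" if "t \<in> {0..1}" for t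
    using \<gamma>[OF that] vector_derivative_works has_vector_derivative_at_within
    unfolding \<gamma>'_def by blast
  have cont: "continuous_on {0..1} \<gamma>"
    using d\<gamma> has_vector_derivative_continuous continuous_on_eq_continuous_within by blast
  have ftc: "((\<lambda>t. deriv2 F (\<gamma> t) (\<gamma>' t) w) has_integral (deriv1 F (\<gamma> 1) w - deriv1 F (\<gamma> 0) w)) {0..1}"
  proof (rule fundamental_theorem_of_calculus)
    fix t :: real assume t: "t \<in> {0..1}"
    have "((\<lambda>t. deriv1 F (\<gamma> t) w) has_derivative (\<lambda>h. deriv2 F (\<gamma> t) (h *\<^sub>R \<gamma>' t) w)) (at t within {0..1})"
      using has_derivative_compose[OF d\<gamma>[OF t, unfolded has_vector_derivative_def]
          C2_map_has_derivative_deriv1[OF F]] .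
    then show "((\<lambda>t. deriv1 F (\<gamma> t) w) has_vector_derivative deriv2 F (\<gamma> t) (\<gamma>' t) w) (at t within {0..1})"
      by (simp add: has_vector_derivative_def bilinear_lmul[OF bilinear_deriv2[OF F]])
  qed simp
  let ?g = "\<lambda>t. norm (deriv1 \<Phi> (\<gamma> t) (\<gamma>' t)) * norm (deriv1 \<Phi> (\<gamma> t) w)"
  have "continuous_on {0..1} ?g"
    using cont' unfolding \<gamma>'_def[symmetric]
    by (intro continuous_intros continuous_on_deriv1 \<Phi> cont)
  then have int: "?g integrable_on {0..1}" by (rule integrable_continuous_interval)
  have "norm (integral {0..1} (\<lambda>t. deriv2 F (\<gamma> t) (\<gamma>' t) w)) \<le> integral {0..1} (\<lambda>t. \<beta> * ?g t)"
  proof (rule integral_norm_bound_integral)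
    show "(\<lambda>t. deriv2 F (\<gamma> t) (\<gamma>' t) w) integrable_on {0..1}" using ftc by blast
    show "(\<lambda>t. \<beta> * ?g t) integrable_on {0..1}" using int by (rule integrable_on_mult_right)
    fix t :: real assume "t \<in> {0..1}"
    then show "norm (deriv2 F (\<gamma> t) (\<gamma>' t) w) \<le> \<beta> * ?g t"
      using bound[OF \<gamma>U, of t "\<gamma>' t" w] by (simp add: mult.assoc)
  qed
  then have "\<bar>deriv1 F (\<gamma> 1) w - deriv1 F (\<gamma> 0) w\<bar> \<le> \<beta> * integral {0..1} ?g"
    using integral_unique[OF ftc] by simp
  then show "\<bar>metric_inner (pullback_metric \<Phi> (\<gamma> 1)) (riemannian_gradient (pullback_metric \<Phi>) F (\<gamma> 1)) w
          - metric_inner (pullback_metric \<Phi> (\<gamma> 0)) (riemannian_gradient (pullback_metric \<Phi>) F (\<gamma> 0)) w\<bar>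
        \<le> \<beta> * integral {0..1} (\<lambda>t. metric_norm (pullback_metric \<Phi> (\<gamma> t)) (vector_derivative \<gamma> (at t))
            * metric_norm (pullback_metric \<Phi> (\<gamma> t)) w)"
    by (simp add: metric_inner_riemannian_gradient[OF \<Phi> inj F] metric_norm_pullback[OF \<Phi>] \<gamma>'_def)
qed

section \<open>Restriction to a graph\<close>

context
  fixes \<Psi> :: "'a::euclidean_space \<Rightarrow> 'b::euclidean_space" and \<Phi> :: "'a \<Rightarrow> 'a \<times> 'b"
  assumes \<Psi>: "C2_map \<Psi>" and \<Phi>_def: "\<Phi> = (\<lambda>x. (x, \<Psi> x))"
begin

lemma C2_map_graph_param: "C2_map \<Phi>"
  unfolding \<Phi>_def by (rule C2_map_graph[OF \<Psi>])

lemma deriv1_graph_param: "deriv1 \<Phi> x v = (v, deriv1 \<Psi> x v)"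
  unfolding \<Phi>_def by (rule deriv1_graph[OF \<Psi>])

lemma norm_le_norm_deriv1_graph: "norm v \<le> norm (deriv1 \<Phi> x v)"
  by (metis deriv1_graph_param norm_fst_le)

lemma deriv1_graph_eq_0: "deriv1 \<Phi> x v = 0 \<Longrightarrow> v = 0"
  using norm_le_norm_deriv1_graph[of v x] by simp

lemma range_deriv1_graph:
  shows "subspace (range (deriv1 \<Phi> x))" and "range (deriv1 \<Phi> x) \<noteq> {0}"
proof -
  show "subspace (range (deriv1 \<Phi> x))"
    by (rule linear_subspace_image[OF linear_deriv1[OF C2_map_graph_param] subspace_UNIV])
  have "deriv1 \<Phi> x (SOME b. b \<in> Basis) \<noteq> 0"
    using deriv1_graph_eq_0 nonzero_Basis[OF SOME_Basis] by blast
  then show "range (deriv1 \<Phi> x) \<noteq> {0}" by (metis rangeI singletonD)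
qed

lemma lambda_min_graph_le: "lambda_min (pullback_metric \<Phi> x) * (norm v)\<^sup>2 \<le> (norm (deriv1 \<Phi> x v))\<^sup>2"
  using lambda_min_le_quadratic_form[OF linear_pullback_metric pullback_metric_symmetric,
      OF C2_map_graph_param C2_map_graph_param, of x v]
    metric_inner_pullback[OF C2_map_graph_param, of x v v]
  by (simp add: metric_inner_def power2_norm_eq_inner)

lemma lambda_min_graph_ge_1: "1 \<le> lambda_min (pullback_metric \<Phi> x)"
proof -
  let ?R = "pullback_metric \<Phi> x"
  obtain v where v: "v \<noteq> 0" "?R v = lambda_min ?R *\<^sub>R v"
    using lambda_min_eigenvalue[OF linear_pullback_metric pullback_metric_symmetric]
      C2_map_graph_param by blast
  have "(norm v)\<^sup>2 \<le> (norm (deriv1 \<Phi> x v))\<^sup>2"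
    using norm_le_norm_deriv1_graph by (intro power_mono) auto
  also have "\<dots> = v \<bullet> ?R v"
    using metric_inner_pullback[OF C2_map_graph_param, of x v v]
    by (simp add: metric_inner_def power2_norm_eq_inner)
  also have "\<dots> = lambda_min ?R * (norm v)\<^sup>2" by (simp add: v(2) power2_norm_eq_inner)
  finally show ?thesis using v(1) by simp
qed

text \<open>A direction annihilated by the projection is an eigenvector of \<open>D\<Phi>\<^sup>T D\<Phi>\<close> for the
  eigenvalue 1.\<close>

lemma lambda_min_graph_orth_projection:
  assumes "is_orth_projection \<Psi>"
  shows "lambda_min (pullback_metric \<Phi> x) = 1"
proof (rule antisym[OF _ lambda_min_graph_ge_1])
  obtain V J where V: "subspace V" "V \<noteq> UNIV" and J: "linear J" and eq: "\<Psi> = (\<lambda>x. J (orth_proj V x))"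
    using assms unfolding is_orth_projection_def by blast
  have "linear \<Psi>" unfolding eq using linear_compose[OF linear_orth_proj[OF V(1)] J] by (simp add: o_def)
  then have "deriv1 \<Psi> x = \<Psi>"
    by (intro deriv1_eqI linear_imp_has_derivative)
  obtain z where z: "z \<notin> V" using V(2) by blast
  define v where "v = z - orth_proj V z"
  have "v \<noteq> 0" using z orth_proj_mem[OF V(1), of z] by (auto simp: v_def)
  have "orth_proj V v = 0"
    using orth_proj_orthogonal[OF V(1)] by (intro orth_proj_unique V(1) subspace_0) (simp add: v_def)
  then have "deriv1 \<Psi> x v = 0"
    using \<open>deriv1 \<Psi> x = \<Psi>\<close> J by (simp add: eq linear_0)
  then have "\<forall>u. u \<bullet> pullback_metric \<Phi> x v = u \<bullet> v"
    using metric_inner_pullback[OF C2_map_graph_param, of x _ v]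
    by (simp add: metric_inner_def deriv1_graph_param)
  then have "pullback_metric \<Phi> x v = 1 *\<^sub>R v" by (simp add: vector_eq_ldot)
  with \<open>v \<noteq> 0\<close> show "lambda_min (pullback_metric \<Phi> x) \<le> 1"
    by (rule lambda_min_le_eigenvalue[OF pullback_metric_symmetric[OF C2_map_graph_param]])
qed

text \<open>The second derivative of \<open>f \<circ> \<Phi>\<close> is the restriction of \<open>D\<^sup>2f\<close> to the tangent space plus a
  curvature term.  As \<open>D\<^sup>2\<Phi> = (0, D\<^sup>2\<Psi>)\<close>, that term only involves the partial gradient of \<open>f\<close> in
  the second variable.\<close>

lemma deriv2_compose_graph:
  fixes f :: "'a \<times> 'b \<Rightarrow> real"
  assumes f: "C2_map f"
  shows "deriv2 (f \<circ> \<Phi>) x u v = deriv1 \<Phi> x u \<bullet> hessian f (\<Phi> x) (deriv1 \<Phi> x v)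
           + gradient (\<lambda>x2. f (x, x2)) (\<Psi> x) \<bullet> deriv2 \<Psi> x u v"
proof -
  have "((\<lambda>x2. (x, x2)) has_derivative (\<lambda>k. (0, k))) (at (\<Psi> x))"
    by (intro has_derivative_Pair has_derivative_const has_derivative_ident)
  from has_derivative_compose[OF this C2_map_has_derivative[OF f]]
  have "gradient (\<lambda>x2. f (x, x2)) (\<Psi> x) \<bullet> k = deriv1 f (\<Phi> x) (0, k)" for k
    unfolding \<Phi>_def by (rule inner_gradient)
  moreover have "deriv2 \<Phi> x u v = (0, deriv2 \<Psi> x u v)"
    unfolding \<Phi>_def by (rule deriv2_graph[OF \<Psi>])
  ultimately show ?thesis
    by (simp add: deriv2_compose[OF f C2_map_graph_param] hessian_symmetric[OF f] inner_hessian[OF f])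
qed

text \<open>The curvature term is at most \<open>Q Z |y|\<^sup>2\<close>; dividing by \<open>m\<close> expresses it in the metric, since
  \<open>m |y|\<^sup>2 \<le> |D\<Phi> y|\<^sup>2\<close>.\<close>

lemma abs_hessian_compose_graph_le:
  fixes f :: "'a \<times> 'b \<Rightarrow> real"
  assumes f: "C2_map f" and m: "0 < m" "m \<le> lambda_min (pullback_metric \<Phi> x)"
    and Q: "bilinear_norm (deriv2 \<Psi> x) \<le> Q"
    and Z: "norm (gradient (\<lambda>x2. f (x, x2)) (\<Psi> x)) \<le> Z" and pos: "0 \<le> Q" "0 \<le> Z"
  shows "\<bar>y \<bullet> hessian (f \<circ> \<Phi>) x y\<bar> \<le>
     (sigma_max_on (hessian f (\<Phi> x)) (range (deriv1 \<Phi> x)) + Q * Z / m)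
       * metric_inner (pullback_metric \<Phi> x) y y"
proof -
  let ?D = "deriv1 \<Phi> x" and ?A = "hessian f (\<Phi> x)"
  let ?g = "gradient (\<lambda>x2. f (x, x2)) (\<Psi> x)" and ?B = "deriv2 \<Psi> x"
  have "\<bar>?g \<bullet> ?B y y\<bar> \<le> bilinear_norm ?B * norm ?g * (norm y)\<^sup>2"
    by (rule inner_bilinear_le_bilinear_norm[OF bilinear_deriv2[OF \<Psi>]])
  also have "\<dots> \<le> Q * norm ?g * (norm y)\<^sup>2"
    using Q by (intro mult_right_mono) auto
  also have "\<dots> \<le> Q * Z * (norm y)\<^sup>2"
    using Z pos by (intro mult_right_mono mult_left_mono) auto
  also have "\<dots> = Q * Z / m * (m * (norm y)\<^sup>2)" using m by simp
  also have "\<dots> \<le> Q * Z / m * (norm (?D y))\<^sup>2"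
  proof (rule mult_left_mono)
    have "m * (norm y)\<^sup>2 \<le> lambda_min (pullback_metric \<Phi> x) * (norm y)\<^sup>2"
      using m by (intro mult_right_mono) auto
    then show "m * (norm y)\<^sup>2 \<le> (norm (?D y))\<^sup>2" using lambda_min_graph_le[of x y] by linarith
  qed (use pos m in auto)
  finally have curv: "\<bar>?g \<bullet> ?B y y\<bar> \<le> Q * Z / m * (norm (?D y))\<^sup>2" .
  have tang: "\<bar>?D y \<bullet> ?A (?D y)\<bar> \<le> sigma_max_on ?A (range ?D) * (norm (?D y))\<^sup>2"
    by (rule abs_quadratic_form_le_sigma_max_on[OF linear_hessian[OF f] hessian_symmetric[OF f]
          range_deriv1_graph(1)]) simp
  have "y \<bullet> hessian (f \<circ> \<Phi>) x y = ?D y \<bullet> ?A (?D y) + ?g \<bullet> ?B y y"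
    by (simp add: inner_commute[of y] inner_hessian[OF C2_map_compose[OF f C2_map_graph_param]]
        deriv2_compose_graph[OF f])
  then show ?thesis
    using curv tang by (simp add: metric_inner_pullback[OF C2_map_graph_param]
        power2_norm_eq_inner[symmetric] distrib_right)
qed

end

section \<open>Curvature reduction\<close>

theorem theorem2:
  fixes f :: "(real ^ 'n1) \<times> (real ^ 'n2) \<Rightarrow> real"
    and \<Psi> :: "real ^ 'n1 \<Rightarrow> real ^ 'n2"
    and \<Phi> :: "real ^ 'n1 \<Rightarrow> (real ^ 'n1) \<times> (real ^ 'n2)"
    and F :: "real ^ 'n1 \<Rightarrow> real"
    and \<N> M\<^sub>F M_loc S :: "((real ^ 'n1) \<times> (real ^ 'n2)) set"
    and U :: "(real ^ 'n1) set"
    and T :: "(real ^ 'n1) \<times> (real ^ 'n2) \<Rightarrow> ((real ^ 'n1) \<times> (real ^ 'n2)) set"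
    and x_bar :: "(real ^ 'n1) \<times> (real ^ 'n2)"
    and L \<beta>\<^sub>f \<mu>\<^sub>f \<beta>\<^sub>F \<epsilon> \<Delta>_max Q Z m \<delta> :: real
    and p :: nat
  assumes f_C2: "C2_map f"
    and \<Psi>_C2: "C2_map \<Psi>"
    and \<Phi>_eq: "\<Phi> = (\<lambda>x1. (x1, \<Psi> x1))"
    and F_eq: "F = f \<circ> \<Phi>"
    and M\<^sub>F_eq: "M\<^sub>F = range \<Phi>"
    and M_loc_eq: "M_loc = M\<^sub>F \<inter> \<N>"
    and U_eq: "U = {x1. \<Phi> x1 \<in> \<N>}"
    and T_eq: "\<And>x1. T (\<Phi> x1) = range (deriv1 \<Phi> x1)"
    and S_eq: "S = zero_minimisers f"
    \<comment> \<open>standing assumptions on \<open>f\<close>\<close>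
    and f_inf: "\<forall>x. 0 \<le> f x" "\<exists>x. f x = 0"
    and nbhd: "x_bar \<in> S" "compact \<N>" "x_bar \<in> interior \<N>"
    and consts_pos: "L > 0" "\<beta>\<^sub>f > 0" "\<mu>\<^sub>f > 0"
    and f_lipschitz: "lipschitz_on L \<N> f"
    and \<beta>\<^sub>f_eq: "\<beta>\<^sub>f = (SUP x \<in> \<N>. onorm (hessian f x))"
    and f_smooth: "lipschitz_on \<beta>\<^sub>f \<N> (gradient f)"
    and f_PL: "\<forall>x \<in> \<N>. f x \<le> 1 / (2 * \<mu>\<^sub>f) * (norm (gradient f x))\<^sup>2"
    \<comment> \<open>standing assumptions on \<open>F\<close>\<close>
    and S_F: "M\<^sub>F \<inter> S \<noteq> {}" "M\<^sub>F \<inter> S = \<Phi> ` {x1. \<forall>y1. F x1 \<le> F y1}"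
    and M_loc_nonempty: "M_loc \<noteq> {}"
    \<comment> \<open>dominant subspace and spectral gap\<close>
    and p_pos: "p \<ge> 1"
    and multiplicity: "\<forall>x \<in> M_loc. sigma_max_multiplicity (hessian f x) = p"
    and eps: "0 < \<epsilon>" "\<epsilon> \<le> 1"
    and angle: "\<forall>x \<in> M_loc. \<forall>v \<in> dominant_subspace (hessian f x).
                  norm v = 1 \<longrightarrow> norm (orth_proj (T x) v) \<le> 1 - \<epsilon>"
    and \<Delta>_max_eq: "\<Delta>_max =
          (INF x \<in> M_loc. sigma_max (hessian f x) - singular_value (hessian f x) (p + 1))"
    and \<Delta>_max_pos: "\<Delta>_max > 0"
    \<comment> \<open>bounds on the correction term\<close>
    and QZ_pos: "Q > 0" "Z > 0"
    and Q_bound: "\<forall>x1 \<in> U. bilinear_norm (deriv2 \<Psi> x1) \<le> Q"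
    and Z_bound: "\<forall>x1 \<in> U. norm (gradient (\<lambda>x2. f (x1, x2)) (\<Psi> x1)) \<le> Z"
    and m_eq: "m = (INF x1 \<in> U. lambda_min (pullback_metric \<Phi> x1))"
    and \<delta>_eq: "\<delta> = (INF x1 \<in> U. sigma_max (hessian f (\<Phi> x1))
                                 - sigma_max_on (hessian f (\<Phi> x1)) (T (\<Phi> x1)))"
    and correction: "Q * Z / m < \<delta>"
    and \<beta>\<^sub>F_eq: "\<beta>\<^sub>F = (SUP x1 \<in> U. metric_form_norm (pullback_metric \<Phi> x1) (hessian F x1))"
  shows "bdd_above ((\<lambda>x1. metric_form_norm (pullback_metric \<Phi> x1) (hessian F x1)) ` U)
       \<and> riemannian_gradient_lipschitz_on \<beta>\<^sub>F U (pullback_metric \<Phi>) F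
       \<and> \<beta>\<^sub>F \<le> \<beta>\<^sub>f - \<Delta>_max * (2 * \<epsilon> - \<epsilon>\<^sup>2) + Q * Z / m
       \<and> \<beta>\<^sub>F < \<beta>\<^sub>f
       \<and> (is_orth_projection \<Psi> \<longrightarrow> m = 1)"
proof -
  have C2\<Phi>: "C2_map \<Phi>" by (rule C2_map_graph_param[OF \<Psi>_C2 \<Phi>_eq])
  have C2F: "C2_map F" unfolding F_eq by (rule C2_map_compose[OF f_C2 C2\<Phi>])
  note linA = linear_hessian[OF f_C2] and symA = hessian_symmetric[OF f_C2]
  note injD = deriv1_graph_eq_0[OF \<Psi>_C2 \<Phi>_eq]
  have U_ne: "U \<noteq> {}" using M_loc_nonempty by (auto simp: M_loc_eq M\<^sub>F_eq U_eq)
  have M_loc_U: "M_loc = \<Phi> ` U" by (auto simp: M_loc_eq M\<^sub>F_eq U_eq)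
  \<comment> \<open>\<open>K\<close> and \<open>\<sigma>\<close> are the tangential and the full curvature of \<open>f\<close> at \<open>\<Phi>(x1)\<close>, and \<open>N\<close> is the
    quantity whose supremum is \<open>\<beta>\<^sub>F\<close>.\<close>
  define K where "K x1 = sigma_max_on (hessian f (\<Phi> x1)) (T (\<Phi> x1))" for x1
  define \<sigma> where "\<sigma> x1 = sigma_max (hessian f (\<Phi> x1))" for x1
  define N where "N x1 = metric_form_norm (pullback_metric \<Phi> x1) (hessian F x1)" for x1
  have T: "subspace (T (\<Phi> x1))" "T (\<Phi> x1) \<noteq> {0}" for x1
    using range_deriv1_graph[OF \<Psi>_C2 \<Phi>_eq, of x1] by (simp_all add: T_eq)

  have \<sigma>_le: "\<sigma> x1 \<le> \<beta>\<^sub>f" if "x1 \<in> U" for x1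
  proof -
    have "\<sigma> x1 \<le> onorm (hessian f (\<Phi> x1))" unfolding \<sigma>_def by (rule sigma_max_le_onorm[OF linA symA])
    also have "\<dots> \<le> \<beta>\<^sub>f" unfolding \<beta>\<^sub>f_eq
      using that by (intro cSUP_upper bdd_above_onorm_hessian f_C2 nbhd) (simp add: U_eq)
    finally show ?thesis .
  qed

  have m_le: "m \<le> lambda_min (pullback_metric \<Phi> x1)" if "x1 \<in> U" for x1
    unfolding m_eq
    using that by (intro cINF_lower bdd_belowI2[of _ 1] lambda_min_graph_ge_1[OF \<Psi>_C2 \<Phi>_eq])
  have "1 \<le> m" unfolding m_eq
    by (intro cINF_greatest U_ne lambda_min_graph_ge_1[OF \<Psi>_C2 \<Phi>_eq])
  then have m_pos: "0 < m" by simp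

  have form: "\<bar>y \<bullet> hessian F x1 y\<bar> \<le> (K x1 + Q * Z / m) * metric_inner (pullback_metric \<Phi> x1) y y"
    if "x1 \<in> U" for x1 y
    unfolding F_eq K_def T_eq
    using that m_pos m_le Q_bound Z_bound QZ_pos
    by (intro abs_hessian_compose_graph_le[OF \<Psi>_C2 \<Phi>_eq f_C2]) auto
  have metric_pos: "0 < metric_inner (pullback_metric \<Phi> x1) y y" if "y \<noteq> 0" for x1 y
    using that injD by (auto simp: metric_inner_pullback[OF C2\<Phi>])
  have N_le: "N x1 \<le> K x1 + Q * Z / m" and N_nonneg: "0 \<le> N x1"
    and form_N: "\<And>y. y \<noteq> 0 \<Longrightarrow> \<bar>y \<bullet> hessian F x1 y\<bar> \<le> N x1 * metric_inner (pullback_metric \<Phi> x1) y y"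
    if "x1 \<in> U" for x1
    using metric_form_norm_bound[OF metric_pos form[OF that]] unfolding N_def by auto

  have K_angle: "K x1 \<le> \<sigma> x1 - \<Delta>_max * (2 * \<epsilon> - \<epsilon>\<^sup>2)" if x1: "x1 \<in> U" for x1
  proof -
    \<comment> \<open>Stated at every point \<open>y\<close> of \<open>U\<close>, since the infimum \<open>\<Delta>_max\<close> is only meaningful once its
      family is known to be bounded below.\<close>
    have s: "singular_value (hessian f (\<Phi> y)) (p + 1) \<le> \<sigma> y"
      and form_T: "\<And>w. w \<in> T (\<Phi> y) \<Longrightarrow> norm w = 1 \<Longrightarrow> \<bar>w \<bullet> hessian f (\<Phi> y) w\<bar>
              \<le> \<sigma> y - (\<sigma> y - singular_value (hessian f (\<Phi> y)) (p + 1)) * (2 * \<epsilon> - \<epsilon>\<^sup>2)"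
      if y: "y \<in> U" for y
    proof -
      have mult: "sigma_max_multiplicity (hessian f (\<Phi> y)) = p"
        and ang: "\<And>v. v \<in> dominant_subspace (hessian f (\<Phi> y)) \<Longrightarrow> norm v = 1 \<Longrightarrow>
                norm (orth_proj (T (\<Phi> y)) v) \<le> 1 - \<epsilon>"
        using multiplicity angle y unfolding M_loc_U by auto
      have bound: "singular_value (hessian f (\<Phi> y)) (p + 1) \<le> \<sigma> y"
          "\<bar>w \<bullet> hessian f (\<Phi> y) w\<bar>
              \<le> \<sigma> y - (\<sigma> y - singular_value (hessian f (\<Phi> y)) (p + 1)) * (2 * \<epsilon> - \<epsilon>\<^sup>2)"
        if "w \<in> T (\<Phi> y)" "norm w = 1" for w
        using quadratic_form_on_misaligned_subspace[where A = "hessian f (\<Phi> y)",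
            OF linA symA T(1) that eps ang]
        unfolding mult \<sigma>_def by auto
      \<comment> \<open>Any unit tangent vector shows that the dominant subspace is not the whole space, so
        that a singular value with index \<open>p + 1\<close> exists.\<close>
      obtain t where t: "t \<in> T (\<Phi> y)" "t \<noteq> 0" using T subspace_0 by blast
      have "sgn t \<in> T (\<Phi> y)" "norm (sgn t) = 1"
        using t T(1) by (simp_all add: sgn_div_norm subspace_scale)
      then show "singular_value (hessian f (\<Phi> y)) (p + 1) \<le> \<sigma> y" by (rule bound(1))
      show "\<bar>w \<bullet> hessian f (\<Phi> y) w\<bar>
              \<le> \<sigma> y - (\<sigma> y - singular_value (hessian f (\<Phi> y)) (p + 1)) * (2 * \<epsilon> - \<epsilon>\<^sup>2)"
        if "w \<in> T (\<Phi> y)" "norm w = 1" for w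
        by (rule bound(2)[OF that])
    qed
    have g: "\<Delta>_max \<le> \<sigma> x1 - singular_value (hessian f (\<Phi> x1)) (p + 1)"
      unfolding \<Delta>_max_eq M_loc_U \<sigma>_def
      using x1 s by (intro cINF_lower bdd_belowI2[of _ 0]) (auto simp: \<sigma>_def)
    have "0 \<le> \<epsilon> * (2 - \<epsilon>)" using eps by (intro mult_nonneg_nonneg) auto
    then have e: "0 \<le> 2 * \<epsilon> - \<epsilon>\<^sup>2" by (simp add: power2_eq_square algebra_simps)
    show "K x1 \<le> \<sigma> x1 - \<Delta>_max * (2 * \<epsilon> - \<epsilon>\<^sup>2)"
      unfolding K_def
    proof (rule sigma_max_on_le[OF linA symA T])
      fix w assume w: "w \<in> T (\<Phi> x1)" "norm w = 1"
      show "\<bar>w \<bullet> hessian f (\<Phi> x1) w\<bar> \<le> \<sigma> x1 - \<Delta>_max * (2 * \<epsilon> - \<epsilon>\<^sup>2)"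
        using form_T[OF x1 w] mult_right_mono[OF g e] by linarith
    qed
  qed

  have K_\<delta>: "\<delta> \<le> \<sigma> x1 - K x1" if "x1 \<in> U" for x1
    unfolding \<delta>_eq \<sigma>_def K_def
    using that sigma_max_on_le_sigma_max[OF linA symA T]
    by (intro cINF_lower bdd_belowI2[of _ 0]) auto

  \<comment> \<open>Two bounds on the same quantity: the angle condition gives the quantitative estimate, and
    the gap \<open>\<delta>\<close> gives the strict decrease.\<close>
  have N1: "N x1 \<le> \<beta>\<^sub>f - \<Delta>_max * (2 * \<epsilon> - \<epsilon>\<^sup>2) + Q * Z / m" if "x1 \<in> U" for x1
    using N_le[OF that] K_angle[OF that] \<sigma>_le[OF that] by linarith
  have N2: "N x1 \<le> \<beta>\<^sub>f - \<delta> + Q * Z / m" if "x1 \<in> U" for x1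
    using N_le[OF that] K_\<delta>[OF that] \<sigma>_le[OF that] by linarith
  have bdd: "bdd_above (N ` U)" using N2 by (rule bdd_aboveI2)
  have N_le_\<beta>: "N x1 \<le> \<beta>\<^sub>F" if "x1 \<in> U" for x1
    unfolding \<beta>\<^sub>F_eq N_def[symmetric] by (rule cSUP_upper[OF that bdd])
  have \<beta>_nonneg: "0 \<le> \<beta>\<^sub>F" using U_ne N_nonneg N_le_\<beta> by (meson all_not_in_conv order_trans)

  have "riemannian_gradient_lipschitz_on \<beta>\<^sub>F U (pullback_metric \<Phi>) F"
  proof (rule riemannian_gradient_lipschitz_on_pullback[OF C2\<Phi> injD C2F \<beta>_nonneg])
    fix x u v assume x: "x \<in> U"
    show "\<bar>deriv2 F x u v\<bar> \<le> \<beta>\<^sub>F * norm (deriv1 \<Phi> x u) * norm (deriv1 \<Phi> x v)"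
    proof (rule symmetric_form_polarization[OF bilinear_deriv2[OF C2F] deriv2_commute[OF C2F]
          linear_deriv1[OF C2\<Phi>] injD])
      show "\<bar>deriv2 F x y y\<bar> \<le> \<beta>\<^sub>F * (norm (deriv1 \<Phi> x y))\<^sup>2" for y
      proof (cases "y = 0")
        case True
        then show ?thesis using \<beta>_nonneg by (simp add: bilinear_lzero[OF bilinear_deriv2[OF C2F]])
      next
        case False
        have "\<bar>deriv2 F x y y\<bar> \<le> N x * (norm (deriv1 \<Phi> x y))\<^sup>2"
          using form_N[OF x False] by (simp add: metric_inner_pullback[OF C2\<Phi>] power2_norm_eq_inner
              inner_hessian[OF C2F, symmetric] inner_commute[of y])
        also have "\<dots> \<le> \<beta>\<^sub>F * (norm (deriv1 \<Phi> x y))\<^sup>2"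
          using N_le_\<beta>[OF x] by (intro mult_right_mono) auto
        finally show ?thesis .
      qed
    qed
  qed
  moreover have "\<beta>\<^sub>F \<le> \<beta>\<^sub>f - \<Delta>_max * (2 * \<epsilon> - \<epsilon>\<^sup>2) + Q * Z / m"
    unfolding \<beta>\<^sub>F_eq N_def[symmetric] by (rule cSUP_least[OF U_ne N1])
  moreover have "\<beta>\<^sub>F \<le> \<beta>\<^sub>f - \<delta> + Q * Z / m"
    unfolding \<beta>\<^sub>F_eq N_def[symmetric] by (rule cSUP_least[OF U_ne N2])
  then have "\<beta>\<^sub>F < \<beta>\<^sub>f" using correction by linarith
  moreover have "m = 1" if "is_orth_projection \<Psi>"
    unfolding m_eq using U_ne by (simp add: lambda_min_graph_orth_projection[OF \<Psi>_C2 \<Phi>_eq that])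
  ultimately show ?thesis using bdd unfolding N_def by blast
qed

end
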